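(* (1) Let $\lambda$ be an infinite cardinal with $\lambda^{<\lambda}=\lambda$ and suppose $\mathrm{GMA}_{\lambda^+}$ holds. Then there is a partition $p:[\lambda^+]^2\to\lambda$ such that for every coloring $c:[\lambda^+]^2\to\lambda$ there is a decomposition of $\lambda^+$ into pairwise disjoint sets $\lambda^+=\biguplus_{i<\lambda}X_i$ such that for all $i,j<\lambda$, $$|\{c(\alpha,\beta)\mid (\alpha,\beta)\in[X_i]^2\ \&\ p(\alpha,\beta)=j\}|=1.$$ (2) Suppose $\mathrm{MA}_{\aleph_1}(K)$ holds. Then for every partition $p:[\aleph_1]^2\to\aleph_0$ with finite-to-one fibers and every coloring $c:[\aleph_1]^2\to\aleph_0$ there is a decomposition of $\aleph_1$ into pairwise disjoint sets $\aleph_1=\biguplus_{i<\omega}X_i$ such that for all $i,j<\omega$ the set $\{c(\alpha,\beta)\mid (\alpha,\beta)\in[X_i]^2\ \&\ p(\alpha,\beta)=j\}$ is finite.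
   Context: For a set of ordinals $A$, $[A]^2$ denotes the set of pairs $(\alpha,\beta)$ with $\alpha,\beta\in A$ and $\alpha<\beta$; functions on $[A]^2$ are written $c(\alpha,\beta)$. A partition $p:[\kappa]^2\to\mu$ has finite-to-one fibers if for all $\beta<\kappa$ and $j<\mu$ the set $\{\alpha<\beta\mid p(\alpha,\beta)=j\}$ is finite. Forcing convention: $q\le r$ means $q$ extends $r$. A poset has Property K if every uncountable set of conditions has an uncountable subset of pairwise compatible conditions. $\mathrm{MA}_{\aleph_1}(K)$: for every poset $\mathbb Q$ with Property K and every sequence $\langle D_\beta\mid\beta<\omega_1\rangle$ of dense subsets of $\mathbb Q$ there is a filter on $\mathbb Q$ meeting every $D_\beta$. A poset is well-met if any two compatible conditions have a greatest lower bound. It satisfies the $\lambda^+$-stationary chain condition if for every sequence $\langle q_\delta\mid\delta<\lambda^+\rangle$ of conditions there are a club $D\subseteq\lambda^+$ and a regressive map $h:D\cap E^{\lambda^+}_{\mathrm{cf}(\lambda)}\to\lambda^+$ (i.e. $h(\delta)<\delta$), where $E^{\lambda^+}_{\mathrm{cf}(\lambda)}$ is the set of ordinals below $\lambda^+$ of cofinality $\mathrm{cf}(\lambda)$, such that $h(\gamma)=h(\delta)$ implies $q_\gamma,q_\delta$ are compatible. $\mathrm{GMA}_{\lambda^+}$ (Generalized Martin's Axiom) asserts: for every poset $\mathbb Q$ of size $<2^\lambda$ which is well-met, in which every decreasing sequence of length $\sigma<\lambda$ has a greatest lower bound, and which satisfies the $\lambda^+$-stationary chain condition, and for every sequence $\langle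 D_\beta\mid\beta<\lambda^+\rangle$ of dense subsets of $\mathbb Q$, there is a filter on $\mathbb Q$ meeting each $D_\beta$. *)

theory Defs
  imports Main "HOL-Library.FuncSet" "HOL-Library.Disjoint_Sets" "HOL-Library.Countable_Set"
begin

unbundle cardinal_syntax

text \<open>
  Ordinals and cardinals are the well-order relations of the cardinal library: the ordinals below
  a cardinal \<open>r\<close> are the elements of \<open>Field r\<close>, and \<open>\<alpha> < \<beta>\<close> is \<open>\<alpha> \<in> underS r \<beta>\<close>.
  The successor of \<open>\<lambda>\<close> is \<open>cardSuc \<lambda>\<close>, and \<open>\<aleph>\<^sub>1\<close> is \<open>cardSuc natLeq\<close>.
\<close>

abbreviation omega1 :: "nat set rel" where
  "omega1 \<equiv> cardSuc natLeq"

definition pairs :: "'a rel \<Rightarrow> 'a set \<Rightarrow> ('a \<times> 'a) set" where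
  "pairs r A = {(\<alpha>, \<beta>). \<alpha> \<in> A \<and> \<beta> \<in> A \<and> \<alpha> \<in> underS r \<beta>}"

definition finite_to_one_fibers :: "'a rel \<Rightarrow> 'b set \<Rightarrow> ('a \<times> 'a \<Rightarrow> 'b) \<Rightarrow> bool" where
  "finite_to_one_fibers r J p \<longleftrightarrow>
     (\<forall>\<beta>\<in>Field r. \<forall>j\<in>J. finite {\<alpha> \<in> underS r \<beta>. p (\<alpha>, \<beta>) = j})"

text \<open>
  \<open>\<lambda>\<^bsup><\<lambda>\<^esup>\<close> as the number of sequences in \<open>\<lambda>\<close> of length below \<open>\<lambda>\<close>. The sum over the lengths is
  disjoint because \<^const>\<open>Func\<close> does not record the domain of a function.
\<close>

definition cexp_less :: "'a rel \<Rightarrow> ('a \<times> ('a \<Rightarrow> 'a)) rel" where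
  "cexp_less r = |SIGMA \<sigma> : Field r. Func (underS r \<sigma>) (Field r)|"

text \<open>
  Cofinality is defined with the weak order, so that it also has the usual values \<open>0\<close> and \<open>1\<close> at
  zero and at successors. (The library predicate \<^const>\<open>cofinal\<close> is strict.)
\<close>

definition weakly_cofinal :: "'a rel \<Rightarrow> 'a set \<Rightarrow> bool" where
  "weakly_cofinal r A \<longleftrightarrow> A \<subseteq> Field r \<and> (\<forall>x\<in>Field r. \<exists>a\<in>A. (x, a) \<in> r)"

definition cof :: "'a rel \<Rightarrow> 'a rel" where
  "cof r = (SOME k. \<exists>A. weakly_cofinal r A \<and> k = |A| \<and> (\<forall>B. weakly_cofinal r B \<longrightarrow> |A| \<le>o |B| ))"

definition cof_points :: "'a rel \<Rightarrow> 'b rel \<Rightarrow> 'a set" where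
  "cof_points r k = {\<delta> \<in> Field r. cof (Restr r (underS r \<delta>)) =o k}"

definition closed_in_ord :: "'a rel \<Rightarrow> 'a set \<Rightarrow> bool" where
  "closed_in_ord r D \<longleftrightarrow>
     (\<forall>\<delta>\<in>Field r. underS r \<delta> \<noteq> {} \<and> (\<forall>\<alpha>\<in>underS r \<delta>. \<exists>\<gamma>\<in>D \<inter> underS r \<delta>. \<alpha> \<in> underS r \<gamma>)
        \<longrightarrow> \<delta> \<in> D)"

definition club :: "'a rel \<Rightarrow> 'a set \<Rightarrow> bool" where
  "club r D \<longleftrightarrow> D \<subseteq> Field r \<and> cofinal D r \<and> closed_in_ord r D"

text \<open>A poset is a carrier \<open>Q\<close> with a relation \<open>le\<close>; \<open>(q, r) \<in> le\<close> says that \<open>q\<close> extends \<open>r\<close>.\<close>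

definition poset :: "'q set \<Rightarrow> 'q rel \<Rightarrow> bool" where
  "poset Q le \<longleftrightarrow> Q \<noteq> {} \<and> partial_order_on Q le"

definition compatible :: "'q set \<Rightarrow> 'q rel \<Rightarrow> 'q \<Rightarrow> 'q \<Rightarrow> bool" where
  "compatible Q le q r \<longleftrightarrow> (\<exists>s\<in>Q. (s, q) \<in> le \<and> (s, r) \<in> le)"

definition is_glb :: "'q set \<Rightarrow> 'q rel \<Rightarrow> 'q set \<Rightarrow> 'q \<Rightarrow> bool" where
  "is_glb Q le A g \<longleftrightarrow> g \<in> Q \<and> (\<forall>a\<in>A. (g, a) \<in> le) \<and>
     (\<forall>h\<in>Q. (\<forall>a\<in>A. (h, a) \<in> le) \<longrightarrow> (h, g) \<in> le)"

definition dense_in :: "'q set \<Rightarrow> 'q rel \<Rightarrow> 'q set \<Rightarrow> bool" where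
  "dense_in Q le D \<longleftrightarrow> D \<subseteq> Q \<and> (\<forall>q\<in>Q. \<exists>d\<in>D. (d, q) \<in> le)"

definition filter_on :: "'q set \<Rightarrow> 'q rel \<Rightarrow> 'q set \<Rightarrow> bool" where
  "filter_on Q le G \<longleftrightarrow> G \<subseteq> Q \<and> G \<noteq> {} \<and>
     (\<forall>q\<in>G. \<forall>r\<in>Q. (q, r) \<in> le \<longrightarrow> r \<in> G) \<and>
     (\<forall>q\<in>G. \<forall>r\<in>G. \<exists>s\<in>G. (s, q) \<in> le \<and> (s, r) \<in> le)"

definition well_met :: "'q set \<Rightarrow> 'q rel \<Rightarrow> bool" where
  "well_met Q le \<longleftrightarrow> (\<forall>q\<in>Q. \<forall>r\<in>Q. compatible Q le q r \<longrightarrow> (\<exists>g. is_glb Q le {q, r} g))"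

definition seq_glbs :: "'a rel \<Rightarrow> 'q set \<Rightarrow> 'q rel \<Rightarrow> bool" where
  "seq_glbs l Q le \<longleftrightarrow>
     (\<forall>\<sigma>\<in>Field l. \<forall>s \<in> underS l \<sigma> \<rightarrow> Q.
        (\<forall>\<beta>\<in>underS l \<sigma>. \<forall>\<alpha>\<in>underS l \<beta>. (s \<beta>, s \<alpha>) \<in> le)
        \<longrightarrow> (\<exists>g. is_glb Q le (s ` underS l \<sigma>) g))"

definition stationary_cc :: "'a rel \<Rightarrow> 'q set \<Rightarrow> 'q rel \<Rightarrow> bool" where
  "stationary_cc l Q le \<longleftrightarrow>
     (\<forall>q \<in> Field (cardSuc l) \<rightarrow> Q.
        \<exists>D h. club (cardSuc l) D \<and>
          (\<forall>\<delta> \<in> D \<inter> cof_points (cardSuc l) (cof l). h \<delta> \<in> underS (cardSuc l) \<delta>) \<and>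
          (\<forall>\<gamma> \<in> D \<inter> cof_points (cardSuc l) (cof l). \<forall>\<delta> \<in> D \<inter> cof_points (cardSuc l) (cof l).
             h \<gamma> = h \<delta> \<longrightarrow> compatible Q le (q \<gamma>) (q \<delta>)))"

definition property_K :: "'q set \<Rightarrow> 'q rel \<Rightarrow> bool" where
  "property_K Q le \<longleftrightarrow>
     (\<forall>A\<subseteq>Q. \<not> countable A \<longrightarrow>
        (\<exists>B\<subseteq>A. \<not> countable B \<and> (\<forall>q\<in>B. \<forall>r\<in>B. compatible Q le q r)))"

definition GMA_poset :: "'a rel \<Rightarrow> 'q set \<Rightarrow> 'q rel \<Rightarrow> bool" where
  "GMA_poset l Q le \<longleftrightarrow> poset Q le \<and> |Q| <o ctwo ^c l \<and> well_met Q le \<and> seq_glbs l Q le \<and>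
     stationary_cc l Q le"

text \<open>
  The forcing axioms quantify over posets whose carrier lies in one fixed type. Nothing is lost:
  there are at least \<open>2\<^bsup>\<lambda>\<^esup>\<close> elements of type \<^typ>\<open>'a set\<close>, and at least \<open>\<aleph>\<^sub>1\<close> of type
  \<^typ>\<open>nat set\<close>. The lemmas \<open>GMA_any_type\<close> and \<open>MA_K_any_type\<close> below derive the axioms
  for posets over arbitrary types (in the second case of arbitrary cardinality).
\<close>

definition GMA :: "'a rel \<Rightarrow> bool" where
  "GMA l \<longleftrightarrow>
     (\<forall>(Q :: 'a set set) le D.
        GMA_poset l Q le \<and> (\<forall>\<beta>\<in>Field (cardSuc l). dense_in Q le (D \<beta>)) \<longrightarrow>
        (\<exists>G. filter_on Q le G \<and> (\<forall>\<beta>\<in>Field (cardSuc l). G \<inter> D \<beta> \<noteq> {})))"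

definition MA_K :: bool where
  "MA_K \<longleftrightarrow>
     (\<forall>(Q :: nat set set) le D.
        poset Q le \<and> property_K Q le \<and> (\<forall>\<beta>\<in>Field omega1. dense_in Q le (D \<beta>)) \<longrightarrow>
        (\<exists>G. filter_on Q le G \<and> (\<forall>\<beta>\<in>Field omega1. G \<inter> D \<beta> \<noteq> {})))"

lemma cof_witness:
  "\<exists>A. weakly_cofinal r A \<and> cof r = |A| \<and> (\<forall>B. weakly_cofinal r B \<longrightarrow> |A| \<le>o |B| )"
  if "Well_order r"
proof -
  have "refl_on (Field r) r"
    using that by (simp add: order_on_defs)
  then have "weakly_cofinal r (Field r)"
    by (auto simp: weakly_cofinal_def refl_on_def)
  then have "\<exists>k \<in> card_of ` {A. weakly_cofinal r A}. \<forall>k' \<in> card_of ` {A. weakly_cofinal r A}. k \<le>o k'"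
    by (intro exists_minim_Card_order) (auto simp: card_of_Card_order)
  then have "\<exists>k A. weakly_cofinal r A \<and> k = |A| \<and> (\<forall>B. weakly_cofinal r B \<longrightarrow> |A| \<le>o |B| )"
    by auto
  then show ?thesis
    unfolding cof_def by (rule someI_ex)
qed

definition image_rel :: "('p \<Rightarrow> 'q) \<Rightarrow> 'p set \<Rightarrow> 'p rel \<Rightarrow> 'q rel" where
  "image_rel f C le = {(f x, f y) | x y. x \<in> C \<and> y \<in> C \<and> (x, y) \<in> le}"

lemma image_rel_iff:
  "inj_on f C \<Longrightarrow> x \<in> C \<Longrightarrow> y \<in> C \<Longrightarrow> (f x, f y) \<in> image_rel f C le \<longleftrightarrow> (x, y) \<in> le"
  by (auto simp: image_rel_def dest: inj_onD)

lemma poset_image: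
  assumes "poset Q le" "C \<subseteq> Q" "C \<noteq> {}" and inj: "inj_on f C"
  shows "poset (f ` C) (image_rel f C le)"
proof -
  have "le \<subseteq> Q \<times> Q" "refl_on Q le" "trans le" "antisym le"
    using assms by (auto simp: poset_def order_on_defs)
  then have "refl_on (f ` C) (image_rel f C le)"
    using assms by (auto simp: refl_on_def image_rel_iff)
  moreover have "image_rel f C le \<subseteq> f ` C \<times> f ` C"
    by (auto simp: image_rel_def)
  moreover have "trans (image_rel f C le)"
  proof (rule transI)
    fix a b c assume ab: "(a, b) \<in> image_rel f C le" and bc: "(b, c) \<in> image_rel f C le"
    obtain x y where 1: "x \<in> C" "y \<in> C" "(x, y) \<in> le" "a = f x" "b = f y"
      using ab unfolding image_rel_def by blast
    obtain y' z where 2: "y' \<in> C" "z \<in> C" "(y', z) \<in> le" "b = f y'" "c = f z"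
      using bc unfolding image_rel_def by blast
    have "y = y'" using 1 2 inj by (auto dest: inj_onD)
    then show "(a, c) \<in> image_rel f C le"
      using 1 2 \<open>trans le\<close> inj by (auto simp: image_rel_iff dest: transD)
  qed
  moreover have "antisym (image_rel f C le)"
  proof (rule antisymI)
    fix a b assume ab: "(a, b) \<in> image_rel f C le" and ba: "(b, a) \<in> image_rel f C le"
    obtain x y where 1: "x \<in> C" "y \<in> C" "(x, y) \<in> le" "a = f x" "b = f y"
      using ab unfolding image_rel_def by blast
    have "(y, x) \<in> le" using ba 1 inj by (simp add: image_rel_iff)
    then show "a = b" using 1 \<open>antisym le\<close> by (auto dest: antisymD)
  qed
  ultimately show ?thesis
    using assms by (auto simp: poset_def order_on_defs)
qed

lemma compatible_image:
  assumes "inj_on f C" "x \<in> C" "y \<in> C"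
  shows "compatible (f ` C) (image_rel f C le) (f x) (f y) \<longleftrightarrow> compatible C le x y"
  using assms by (auto simp: compatible_def image_rel_iff)

lemma is_glb_image:
  assumes "inj_on f C" "A \<subseteq> C" "g \<in> C"
  shows "is_glb (f ` C) (image_rel f C le) (f ` A) (f g) \<longleftrightarrow> is_glb C le A g"
proof -
  have "(f x, f y) \<in> image_rel f C le \<longleftrightarrow> (x, y) \<in> le" if "x \<in> C" "y \<in> A" for x y
    using assms that by (auto simp: image_rel_iff subset_iff)
  then show ?thesis
    using assms by (auto simp: is_glb_def image_rel_iff)
qed

lemma dense_in_image:
  assumes "inj_on f C" "dense_in C le D"
  shows "dense_in (f ` C) (image_rel f C le) (f ` D)"
proof -
  have "D \<subseteq> C" using assms by (simp add: dense_in_def)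
  moreover have "\<exists>d\<in>D. (f d, f q) \<in> image_rel f C le" if q: "q \<in> C" for q
  proof -
    obtain d where d: "d \<in> D" "(d, q) \<in> le" using assms q unfolding dense_in_def by blast
    then have "(f d, f q) \<in> image_rel f C le"
      using image_rel_iff[OF assms(1), of d q] q \<open>D \<subseteq> C\<close> by blast
    then show ?thesis using d by blast
  qed
  ultimately show ?thesis by (auto simp: dense_in_def)
qed

lemma filter_from_image:
  assumes po: "poset Q le" and "C \<subseteq> Q" and inj: "inj_on f C"
    and G: "filter_on (f ` C) (image_rel f C le) G"
    and D: "\<And>\<beta>. \<beta> \<in> I \<Longrightarrow> D' \<beta> \<subseteq> C \<and> D' \<beta> \<subseteq> D \<beta> \<and> G \<inter> f ` D' \<beta> \<noteq> {}"
  shows "\<exists>G. filter_on Q le G \<and> (\<forall>\<beta>\<in>I. G \<inter> D \<beta> \<noteq> {})"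
proof -
  have le: "refl_on Q le" "trans le"
    using po by (auto simp: poset_def order_on_defs)
  define H where "H = {q \<in> Q. \<exists>x\<in>C. f x \<in> G \<and> (x, q) \<in> le}"
  have sub: "x \<in> H" if "x \<in> C" "f x \<in> G" for x
    using that le \<open>C \<subseteq> Q\<close> by (auto simp: H_def refl_on_def)
  have "H \<noteq> {}"
  proof -
    obtain x where "x \<in> C" "f x \<in> G" using G by (fastforce simp: filter_on_def)
    then show ?thesis using sub by blast
  qed
  moreover have "r \<in> H" if "q \<in> H" "r \<in> Q" "(q, r) \<in> le" for q r
    using that le(2) unfolding H_def by (blast dest: transD)
  moreover have "\<exists>s\<in>H. (s, q) \<in> le \<and> (s, r) \<in> le" if q: "q \<in> H" and r: "r \<in> H" for q r
  proof -
    obtain x where x: "x \<in> C" "f x \<in> G" "(x, q) \<in> le" using q by (auto simp: H_def)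
    obtain y where y: "y \<in> C" "f y \<in> G" "(y, r) \<in> le" using r by (auto simp: H_def)
    obtain t where t: "t \<in> G" "(t, f x) \<in> image_rel f C le" "(t, f y) \<in> image_rel f C le"
      using G x y unfolding filter_on_def by meson
    obtain s where s: "s \<in> C" "t = f s"
      using t G unfolding filter_on_def by blast
    have "(s, x) \<in> le" "(s, y) \<in> le"
      using t s x y inj by (auto simp: image_rel_iff)
    then have "(s, q) \<in> le" "(s, r) \<in> le"
      using x y le(2) by (blast dest: transD)+
    then show ?thesis using sub[of s] s t by blast
  qed
  ultimately have "filter_on Q le H"
    unfolding filter_on_def H_def by blast
  moreover have "H \<inter> D \<beta> \<noteq> {}" if "\<beta> \<in> I" for \<beta>
    using D[OF that] sub by blast
  ultimately show ?thesis by blast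
qed

lemma GMA_poset_image:
  assumes "GMA_poset l Q le" and inj: "inj_on f Q"
  shows "GMA_poset l (f ` Q) (image_rel f Q le)"
proof -
  let ?g = "the_inv_into Q f"
  have gf: "?g (f x) = x" if "x \<in> Q" for x
    using inj that by (rule the_inv_into_f_f)
  have g: "?g y \<in> Q" "f (?g y) = y" if "y \<in> f ` Q" for y
    using that gf by auto
  have "poset (f ` Q) (image_rel f Q le)"
    using assms by (intro poset_image[of Q]) (auto simp: GMA_poset_def poset_def)
  moreover have "|f ` Q| <o ctwo ^c l"
    using assms card_of_image ordLeq_ordLess_trans unfolding GMA_poset_def by blast
  moreover have "well_met (f ` Q) (image_rel f Q le)"
    unfolding well_met_def
  proof (intro ballI impI)
    fix a b assume a: "a \<in> f ` Q" and b: "b \<in> f ` Q" and c: "compatible (f ` Q) (image_rel f Q le) a b"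
    have "compatible Q le (?g a) (?g b)"
      using c compatible_image[OF inj g(1)[OF a] g(1)[OF b]] g a b by simp
    then obtain m where m: "is_glb Q le {?g a, ?g b} m"
      using assms(1) g a b unfolding GMA_poset_def well_met_def by blast
    then have "m \<in> Q" by (simp add: is_glb_def)
    then have "is_glb (f ` Q) (image_rel f Q le) (f ` {?g a, ?g b}) (f m)"
      using m g a b by (subst is_glb_image[OF inj]) auto
    then show "\<exists>g. is_glb (f ` Q) (image_rel f Q le) {a, b} g"
      using g a b by auto
  qed
  moreover have "seq_glbs l (f ` Q) (image_rel f Q le)"
    unfolding seq_glbs_def
  proof (intro ballI impI)
    fix \<sigma> s assume \<sigma>: "\<sigma> \<in> Field l" and s: "s \<in> underS l \<sigma> \<rightarrow> f ` Q"
      and dec: "\<forall>\<beta>\<in>underS l \<sigma>. \<forall>\<alpha>\<in>underS l \<beta>. (s \<beta>, s \<alpha>) \<in> image_rel f Q le"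
    have "((?g \<circ> s) \<beta>, (?g \<circ> s) \<alpha>) \<in> le" if h: "\<beta> \<in> underS l \<sigma>" "\<alpha> \<in> underS l \<beta>" for \<alpha> \<beta>
    proof -
      obtain x y where "s \<beta> = f x" "s \<alpha> = f y" "x \<in> Q" "y \<in> Q" "(x, y) \<in> le"
        using dec h unfolding image_rel_def by blast
      then show ?thesis by (simp add: gf)
    qed
    moreover have gs: "?g \<circ> s \<in> underS l \<sigma> \<rightarrow> Q"
    proof (rule Pi_I)
      fix x assume "x \<in> underS l \<sigma>"
      then have "s x \<in> f ` Q" using s by blast
      then show "(?g \<circ> s) x \<in> Q" using g(1) by (simp only: comp_apply)
    qed
    ultimately obtain m where m: "is_glb Q le ((?g \<circ> s) ` underS l \<sigma>) m"
      using assms(1) \<sigma> unfolding GMA_poset_def seq_glbs_def by blast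
    then have "m \<in> Q" by (simp add: is_glb_def)
    then have "is_glb (f ` Q) (image_rel f Q le) (f ` ((?g \<circ> s) ` underS l \<sigma>)) (f m)"
      using m gs by (subst is_glb_image[OF inj]) auto
    moreover have "f ` ((?g \<circ> s) ` underS l \<sigma>) = s ` underS l \<sigma>"
    proof -
      have "f ((?g \<circ> s) x) = s x" if "x \<in> underS l \<sigma>" for x
      proof -
        have "s x \<in> f ` Q" using s that by blast
        then show ?thesis using g(2) by (simp only: comp_apply)
      qed
      then show ?thesis by (simp only: image_image cong: image_cong)
    qed
    ultimately show "\<exists>g. is_glb (f ` Q) (image_rel f Q le) (s ` underS l \<sigma>) g"
      by auto
  qed
  moreover have "stationary_cc l (f ` Q) (image_rel f Q le)"
    unfolding stationary_cc_def
  proof (intro ballI)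
    fix q assume q: "q \<in> Field (cardSuc l) \<rightarrow> f ` Q"
    let ?E = "cof_points (cardSuc l) (cof l)"
    have "?g \<circ> q \<in> Field (cardSuc l) \<rightarrow> Q"
    proof (rule Pi_I)
      fix x assume "x \<in> Field (cardSuc l)"
      then have "q x \<in> f ` Q" using q by blast
      then show "(?g \<circ> q) x \<in> Q" using g(1) by (simp only: comp_apply)
    qed
    then obtain D h where Dh: "club (cardSuc l) D"
      "\<forall>\<delta>\<in>D \<inter> ?E. h \<delta> \<in> underS (cardSuc l) \<delta>"
      "\<forall>\<gamma>\<in>D \<inter> ?E. \<forall>\<delta>\<in>D \<inter> ?E. h \<gamma> = h \<delta> \<longrightarrow> compatible Q le ((?g \<circ> q) \<gamma>) ((?g \<circ> q) \<delta>)"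
      using assms(1) unfolding GMA_poset_def stationary_cc_def by blast
    have "compatible (f ` Q) (image_rel f Q le) (q \<gamma>) (q \<delta>)"
      if "\<gamma> \<in> D \<inter> ?E" "\<delta> \<in> D \<inter> ?E" "h \<gamma> = h \<delta>" for \<gamma> \<delta>
    proof -
      have "\<gamma> \<in> Field (cardSuc l)" "\<delta> \<in> Field (cardSuc l)"
        using that by (auto simp: cof_points_def)
      then have "q \<gamma> \<in> f ` Q" "q \<delta> \<in> f ` Q"
        using q by auto
      moreover have "compatible Q le (?g (q \<gamma>)) (?g (q \<delta>))"
        using Dh that by auto
      ultimately show ?thesis
        using compatible_image[OF inj g(1) g(1), of "q \<gamma>" "q \<delta>" le] g by simp
    qed
    with Dh show "\<exists>D h. club (cardSuc l) D \<and> (\<forall>\<delta>\<in>D \<inter> ?E. h \<delta> \<in> underS (cardSuc l) \<delta>) \<and>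
      (\<forall>\<gamma>\<in>D \<inter> ?E. \<forall>\<delta>\<in>D \<inter> ?E. h \<gamma> = h \<delta> \<longrightarrow> compatible (f ` Q) (image_rel f Q le) (q \<gamma>) (q \<delta>))"
      by blast
  qed
  ultimately show ?thesis
    by (simp add: GMA_poset_def)
qed

lemma GMA_any_type:
  fixes l :: "'a rel" and Q :: "'q set"
  assumes GMA: "GMA l" and Q: "GMA_poset l Q le"
    and D: "\<And>\<beta>. \<beta> \<in> Field (cardSuc l) \<Longrightarrow> dense_in Q le (D \<beta>)"
  shows "\<exists>G. filter_on Q le G \<and> (\<forall>\<beta>\<in>Field (cardSuc l). G \<inter> D \<beta> \<noteq> {})"
proof -
  have "|Pow (Field l)| =o ctwo ^c l"
    using card_of_Pow_Func[of "Field l"]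
    by (simp add: cexp_def ctwo_def Field_card_of)
  moreover have "|Pow (Field l)| \<le>o |UNIV :: 'a set set|"
    by (simp add: card_of_mono1)
  ultimately have "|Q| \<le>o |UNIV :: 'a set set|"
    using Q ordIso_symmetric ordLess_imp_ordLeq ordLeq_ordIso_trans ordLeq_transitive
    unfolding GMA_poset_def by blast
  then obtain f :: "'q \<Rightarrow> 'a set" where f: "inj_on f Q"
    unfolding card_of_ordLeq[symmetric] by blast
  have D': "dense_in (f ` Q) (image_rel f Q le) (f ` D \<beta>)" if "\<beta> \<in> Field (cardSuc l)" for \<beta>
    using D[OF that] f by (rule dense_in_image[rotated])
  obtain G where G: "filter_on (f ` Q) (image_rel f Q le) G"
    "\<forall>\<beta>\<in>Field (cardSuc l). G \<inter> f ` D \<beta> \<noteq> {}"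
    using GMA[unfolded GMA_def, rule_format, of "f ` Q" "image_rel f Q le" "\<lambda>\<beta>. f ` D \<beta>"]
      GMA_poset_image[OF Q f] D' by blast
  show ?thesis
  proof (rule filter_from_image[OF _ subset_refl f G(1), where D' = D])
    show "poset Q le" using Q by (simp add: GMA_poset_def)
  qed (use D G(2) in \<open>auto simp: dense_in_def\<close>)
qed

lemma MA_K_any_type:
  fixes Q :: "'q set"
  assumes MA: "MA_K" and po: "poset Q le" and K: "property_K Q le"
    and D: "\<And>\<beta>. \<beta> \<in> Field omega1 \<Longrightarrow> dense_in Q le (D \<beta>)"
  shows "\<exists>G. filter_on Q le G \<and> (\<forall>\<beta>\<in>Field omega1. G \<inter> D \<beta> \<noteq> {})"
proof -
  obtain q0 where q0: "q0 \<in> Q" using po by (auto simp: poset_def)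
  have "\<forall>\<beta> q. \<exists>d. \<beta> \<in> Field omega1 \<longrightarrow> q \<in> Q \<longrightarrow> d \<in> D \<beta> \<and> (d, q) \<in> le"
    using D unfolding dense_in_def by blast
  then obtain F where F: "\<And>\<beta> q. \<beta> \<in> Field omega1 \<Longrightarrow> q \<in> Q \<Longrightarrow> F \<beta> q \<in> D \<beta> \<and> (F \<beta> q, q) \<in> le"
    by metis
  have "\<forall>q r. \<exists>s. q \<in> Q \<longrightarrow> s \<in> Q \<and> (compatible Q le q r \<longrightarrow> (s, q) \<in> le \<and> (s, r) \<in> le)"
    unfolding compatible_def by blast
  then obtain g where g: "\<And>q r. q \<in> Q \<Longrightarrow> g q r \<in> Q"
    "\<And>q r. q \<in> Q \<Longrightarrow> compatible Q le q r \<Longrightarrow> (g q r, q) \<in> le \<and> (g q r, r) \<in> le"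
    by metis
  define L where "L = rec_nat {q0} (\<lambda>_ A. A \<union> (case_prod F ` (Field omega1 \<times> A) \<union> case_prod g ` (A \<times> A)))"
  have L0: "L 0 = {q0}"
    and LS: "L (Suc n) = L n \<union> (case_prod F ` (Field omega1 \<times> L n) \<union> case_prod g ` (L n \<times> L n))" for n
    by (simp_all add: L_def)
  define C where "C = (\<Union>n. L n)"
  have FQ: "F \<beta> q \<in> Q" if "\<beta> \<in> Field omega1" "q \<in> Q" for \<beta> q
    using F[OF that] D[OF that(1)] by (auto simp: dense_in_def)
  have LQ: "L n \<subseteq> Q" for n
  proof (induction n)
    case (Suc n)
    then show ?case using FQ g(1) by (auto simp: LS)
  qed (use q0 in \<open>simp add: L0\<close>)
  then have CQ: "C \<subseteq> Q" by (auto simp: C_def)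
  have Lmono: "L n \<subseteq> L m" if "n \<le> m" for n m
    using that by (induction m rule: dec_induct) (auto simp: LS)
  have CF: "F \<beta> q \<in> C" if h: "\<beta> \<in> Field omega1" "q \<in> C" for \<beta> q
  proof -
    obtain n where "q \<in> L n" using h unfolding C_def by blast
    then have "F \<beta> q \<in> L (Suc n)" using h by (auto simp: LS)
    then show ?thesis unfolding C_def by blast
  qed
  have Cg: "g q r \<in> C" if h: "q \<in> C" "r \<in> C" for q r
  proof -
    obtain n m where "q \<in> L n" "r \<in> L m" using h unfolding C_def by blast
    then have "q \<in> L (max n m)" "r \<in> L (max n m)" using Lmono by (meson max.cobounded1 max.cobounded2 subsetD)+
    then have "g q r \<in> L (Suc (max n m))" by (auto simp: LS)
    then show ?thesis unfolding C_def by blast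
  qed
  let ?k = "|UNIV :: nat set set|"
  have infk: "infinite (UNIV :: nat set set)"
    by (simp add: Finite_Set.finite_set)
  have L_card: "|L n| \<le>o ?k" for n
  proof (induction n)
    case 0
    show ?case unfolding L0 by (rule card_of_singl_ordLeq) simp
  next
    case (Suc n)
    have "|Field omega1 \<times> L n| \<le>o ?k" "|L n \<times> L n| \<le>o ?k"
      using Suc infk card_of_Card_order[of "UNIV :: nat set set"]
      by (auto intro!: card_of_Times_ordLeq_infinite_Field card_of_mono1 simp: Field_card_of)
    then have "|case_prod F ` (Field omega1 \<times> L n)| \<le>o ?k" "|case_prod g ` (L n \<times> L n)| \<le>o ?k"
      using card_of_image ordLeq_transitive by blast+
    then show ?case
      unfolding LS using Suc infk card_of_Card_order[of "UNIV :: nat set set"]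
      by (intro card_of_Un_ordLeq_infinite_Field) (simp_all add: Field_card_of)
  qed
  have "|UNIV :: nat set| \<le>o ?k"
    using card_of_ordLeq[of "UNIV :: nat set" "UNIV :: nat set set"] by (metis inj_singleton subset_UNIV)
  then have "|C| \<le>o ?k"
    unfolding C_def using L_card infk by (intro card_of_UNION_ordLeq_infinite) auto
  then obtain f :: "'q \<Rightarrow> nat set" where f: "inj_on f C"
    unfolding card_of_ordLeq[symmetric] by blast
  have compatC: "compatible C le q r" if "q \<in> C" "r \<in> C" "compatible Q le q r" for q r
    using that g(2)[of q r] Cg CQ unfolding compatible_def by blast
  have poC: "poset (f ` C) (image_rel f C le)"
    using po CQ f by (intro poset_image[of Q]) (auto simp: C_def intro!: exI[of _ 0] simp: L0)
  have KC: "property_K (f ` C) (image_rel f C le)"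
    unfolding property_K_def
  proof (intro allI impI)
    fix A assume A: "A \<subseteq> f ` C" "\<not> countable A"
    obtain A' where A': "A' \<subseteq> C" "A = f ` A'" using A(1) by (auto simp: subset_image_iff)
    then have "\<not> countable A'" using A(2) by auto
    then obtain B where B: "B \<subseteq> A'" "\<not> countable B" "\<forall>q\<in>B. \<forall>r\<in>B. compatible Q le q r"
      using K A'(1) CQ unfolding property_K_def by (meson subset_trans)
    have BC: "B \<subseteq> C" using B A' by blast
    have "\<not> countable (f ` B)"
      using B(2) countable_image_inj_on[of f B] f BC inj_on_subset by blast
    moreover have "compatible (f ` C) (image_rel f C le) a b" if ab: "a \<in> f ` B" "b \<in> f ` B" for a b
    proof -
      obtain x y where xy: "x \<in> B" "y \<in> B" "a = f x" "b = f y" using ab by blast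
      then have xC: "x \<in> C" "y \<in> C" using BC by auto
      have "compatible Q le x y" using B(3) xy(1,2) by simp
      then have "compatible C le x y" by (rule compatC[OF xC])
      then show ?thesis using compatible_image[OF f xC, of le] xy(3,4) by simp
    qed
    ultimately show "\<exists>B\<subseteq>A. \<not> countable B \<and> (\<forall>q\<in>B. \<forall>r\<in>B. compatible (f ` C) (image_rel f C le) q r)"
      using B(1) A'(2) by (intro exI[of _ "f ` B"]) auto
  qed
  have DC: "dense_in C le (D \<beta> \<inter> C)" if "\<beta> \<in> Field omega1" for \<beta>
    using F[OF that] CF[OF that] CQ unfolding dense_in_def by blast
  obtain G where G: "filter_on (f ` C) (image_rel f C le) G"
    "\<forall>\<beta>\<in>Field omega1. G \<inter> f ` (D \<beta> \<inter> C) \<noteq> {}"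
    using MA[unfolded MA_K_def, rule_format, of "f ` C" "image_rel f C le" "\<lambda>\<beta>. f ` (D \<beta> \<inter> C)"]
      poC KC dense_in_image[OF f DC] by blast
  show ?thesis
    by (rule filter_from_image[OF po CQ f G(1), where D' = "\<lambda>\<beta>. D \<beta> \<inter> C"]) (use G(2) in auto)
qed

end

theory Submission
  imports Defs
begin

text \<open>
  (1) Let \<open>p(\<cdot>, \<beta>)\<close> map \<open>\<beta>\<close> injectively into a branch of \<open>2\<^bsup><\<kappa>\<^esup>\<close>, with different branches for
  different \<open>\<beta>\<close>, except on a set of size below \<open>\<kappa>\<close> on which every small pattern of values occurs for
  some \<open>\<beta>\<close>. Then two columns of \<open>p\<close> share fewer than \<open>\<kappa>\<close> values. Force with partial maps
  \<open>\<kappa>\<^sup>+ \<rightarrow> \<kappa>\<close> of size below \<open>\<kappa>\<close> for which the colour of a pair inside a cell depends only on \<open>p\<close>. For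
  \<open>\<delta>\<close> of cofinality \<open>\<kappa>\<close>, the points below \<open>\<delta>\<close> at which columns in the domain of \<open>q\<^sub>\<delta>\<close> collide are
  bounded by some \<open>\<epsilon> < \<delta>\<close>; if \<open>h(\<delta>)\<close> codes \<open>\<epsilon>\<close>, the restriction of \<open>q\<^sub>\<delta>\<close> to \<open>\<epsilon>\<close> and the set of
  triples (cell, value of \<open>p\<close>, colour) realised by \<open>q\<^sub>\<delta>\<close>, then equal codes make \<open>q\<^sub>\<gamma> \<union> q\<^sub>\<delta>\<close> a
  condition. The poset has size \<open>\<kappa>\<^sup>+\<close>, which is below \<open>2\<^bsup>\<kappa>\<^esup>\<close> under the axiom.

  (2) Force with finite maps \<open>\<aleph>\<^sub>1 \<rightarrow> \<omega>\<close> together with finitely many bounds on the colours. Among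
  uncountably many conditions with the same bounds, a \<open>\<Delta>\<close>-system of the domains enlarged by the
  finitely many points that \<open>p\<close> sends into a bounded position gives pairwise compatible ones.
\<close>

section \<open>Regular cardinals\<close>

text \<open>A smaller cardinal is isomorphic to a proper initial segment of \<open>r\<close>. This
  supplies lengths for the sequences counted by \<open>cexp_less\<close>.\<close>

lemma ordLess_card_bij_underS:
  assumes "Card_order r" and "|A| <o r"
  obtains a g where "a \<in> Field r" "bij_betw g (underS r a) A"
proof -
  have "Well_order r"
    using assms(1) by (simp add: card_order_on_well_order_on)
  then obtain a where a: "a \<in> Field r" "|A| =o Restr r (underS r a)"
    using assms(2) ordLess_iff_ordIso_Restr[of r "|A|"] card_of_Well_order by blast
  then have "|A| =o |underS r a|"
    using card_of_cong[OF a(2)] \<open>Well_order r\<close>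
    by (simp add: Field_card_of Field_Restr_ofilter wo_rel.underS_ofilter wo_rel_def)
  then have "|underS r a| =o |A|"
    by (rule ordIso_symmetric)
  then show thesis
    using a(1) that card_of_ordIso by metis
qed

locale self_exp =
  fixes \<kappa> :: "'a rel"
  assumes Cinf: "Cinfinite \<kappa>" and self_exp: "cexp_less \<kappa> =o \<kappa>"
begin

abbreviation \<kappa>S :: "'a set rel" where
  "\<kappa>S \<equiv> cardSuc \<kappa>"

lemma \<kappa>_card: "Card_order \<kappa>" and \<kappa>_infinite: "infinite (Field \<kappa>)" and \<kappa>_wo: "wo_rel \<kappa>"
  using Cinf by (auto simp: cinfinite_def wo_rel_def card_order_on_well_order_on)

lemma \<kappa>S_card: "Card_order \<kappa>S" and \<kappa>S_infinite: "infinite (Field \<kappa>S)" and \<kappa>S_wo: "wo_rel \<kappa>S"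
  using Cinfinite_cardSuc[OF Cinf] by (auto simp: cinfinite_def wo_rel_def card_order_on_well_order_on)

lemma Field_\<kappa>_iso: "|Field \<kappa>| =o \<kappa>" and Field_\<kappa>S_iso: "|Field \<kappa>S| =o \<kappa>S"
  using \<kappa>_card \<kappa>S_card card_of_Field_ordIso by blast+

lemma less_\<kappa>S_iff: "|A| <o \<kappa>S \<longleftrightarrow> |A| \<le>o \<kappa>"
  using cardSuc_ordLeq_ordLess[OF \<kappa>_card card_of_Card_order] by blast

lemma le_\<kappa>_inj:
  assumes "|A| \<le>o \<kappa>"
  obtains e where "inj_on e A" "e ` A \<subseteq> Field \<kappa>"
proof -
  have "|A| \<le>o |Field \<kappa>|"
    using assms Field_\<kappa>_iso ordIso_symmetric ordLeq_ordIso_trans by blast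
  then show thesis using that card_of_ordLeq by metis
qed

lemma le_\<kappa>S_inj:
  assumes "|A| \<le>o \<kappa>S"
  obtains e where "inj_on e A" "e ` A \<subseteq> Field \<kappa>S"
proof -
  have "|A| \<le>o |Field \<kappa>S|"
    using assms Field_\<kappa>S_iso ordIso_symmetric ordLeq_ordIso_trans by blast
  then show thesis using that card_of_ordLeq by metis
qed

text \<open>Reindexing along a bijection of \<open>K\<close> with an initial segment of length
  \<sigma> sends these functions injectively into the summand of \<open>cexp_less \<kappa>\<close>
  at \<sigma>.\<close>

lemma sequences_le:
  assumes "|K| <o \<kappa>"
  shows "|Func K (Field \<kappa>)| \<le>o \<kappa>"
proof -
  obtain \<sigma> g where \<sigma>: "\<sigma> \<in> Field \<kappa>" and g: "bij_betw g (underS \<kappa> \<sigma>) K"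
    using ordLess_card_bij_underS[OF \<kappa>_card assms] .
  define F where "F f = (\<sigma>, \<lambda>x. if x \<in> underS \<kappa> \<sigma> then f (g x) else undefined)" for f :: "'b \<Rightarrow> 'a"
  have "inj_on F (Func K (Field \<kappa>))"
  proof (rule inj_onI)
    fix f f' assume f: "f \<in> Func K (Field \<kappa>)" "f' \<in> Func K (Field \<kappa>)" and eq: "F f = F f'"
    have "f y = f' y" if y: "y \<in> K" for y
    proof -
      obtain x where x: "x \<in> underS \<kappa> \<sigma>" "y = g x" using y g by (auto simp: bij_betw_def)
      then show ?thesis using eq by (auto simp: F_def dest!: fun_cong[of _ _ x])
    qed
    moreover have "f y = f' y" if "y \<notin> K" for y using that f by (simp add: Func_def)
    ultimately show "f = f'" by blast
  qed
  moreover have "F ` Func K (Field \<kappa>) \<subseteq> (SIGMA \<sigma> : Field \<kappa>. Func (underS \<kappa> \<sigma>) (Field \<kappa>))"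
    using \<sigma> g by (fastforce simp: F_def Func_def bij_betw_def)
  ultimately have "|Func K (Field \<kappa>)| \<le>o cexp_less \<kappa>"
    unfolding cexp_less_def using card_of_ordLeq by blast
  then show ?thesis using self_exp ordLeq_ordIso_trans by blast
qed

lemma less_\<kappa>_exists_not_in:
  assumes "|A| <o \<kappa>"
  obtains x where "x \<in> Field \<kappa>" "x \<notin> A"
proof -
  have "\<not> Field \<kappa> \<subseteq> A"
    using assms card_of_mono1[of "Field \<kappa>" A] Field_\<kappa>_iso not_ordLess_ordLeq ordIso_ordLeq_trans
      ordIso_symmetric by blast
  then show thesis using that by blast
qed

text \<open>An infinite cardinal has no largest element, so the closed segment lies in an open
  one.\<close>

lemma under_less: "a \<in> Field \<kappa> \<Longrightarrow> |under \<kappa> a| <o \<kappa>"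
proof -
  assume a: "a \<in> Field \<kappa>"
  then obtain b where "b \<in> Field \<kappa>" "a \<noteq> b" "(a, b) \<in> \<kappa>"
    using infinite_Card_order_limit[OF \<kappa>_card \<kappa>_infinite a] by blast
  then have "under \<kappa> a \<subseteq> underS \<kappa> b"
    using wo_rel.TRANS[OF \<kappa>_wo] wo_rel.ANTISYM[OF \<kappa>_wo]
    by (auto simp: under_def underS_def dest: transD antisymD)
  then show ?thesis
    using card_of_mono1 card_of_underS[OF \<kappa>_card \<open>b \<in> Field \<kappa>\<close>] ordLeq_ordLess_trans by blast
qed

text \<open>A diagonal argument: if a cofinal \<open>K\<close> had size below \<kappa>, the
  functions from \<open>K\<close> to \<kappa> would have codes in \<kappa>, and some function would
  differ at each \<open>b\<close> in \<open>K\<close> from every function with code at most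
  \<open>b\<close>. But its own code lies below some \<open>b\<close>.\<close>

lemma regular: "regularCard \<kappa>"
  unfolding regularCard_def
proof (intro allI impI, elim conjE, rule ccontr)
  fix K assume K: "K \<subseteq> Field \<kappa>" "cofinal K \<kappa>" "\<not> |K| =o \<kappa>"
  have "|K| \<le>o \<kappa>"
    using card_of_mono1[OF K(1)] Field_\<kappa>_iso ordLeq_ordIso_trans by blast
  then have "|K| <o \<kappa>" using K(3) ordLeq_iff_ordLess_or_ordIso by blast
  then obtain e where e: "inj_on e (Func K (Field \<kappa>))"
    "e ` Func K (Field \<kappa>) \<subseteq> Field \<kappa>"
    using le_\<kappa>_inj[OF sequences_le] by blast
  define d where "d x = the_inv_into (Func K (Field \<kappa>)) e x" for x
  \<comment> \<open>Fewer than \<kappa> codes are at most \<open>b\<close>, so some value differs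
    from what all of the decoded functions take at \<open>b\<close>.\<close>
  have "\<exists>y. y \<in> Field \<kappa> \<and> y \<notin> (\<lambda>x. d x b) ` under \<kappa> b" if "b \<in> K" for b
  proof -
    have "|(\<lambda>x. d x b) ` under \<kappa> b| <o \<kappa>"
      using under_less[of b] K(1) that card_of_image ordLeq_ordLess_trans by blast
    then show ?thesis using less_\<kappa>_exists_not_in by blast
  qed
  then obtain g0 where g0: "\<And>b. b \<in> K \<Longrightarrow> g0 b \<in> Field \<kappa> \<and> g0 b \<notin> (\<lambda>x. d x b) ` under \<kappa> b"
    by metis
  define g where "g = (\<lambda>b. if b \<in> K then g0 b else undefined)"
  have gF: "g \<in> Func K (Field \<kappa>)" using g0 by (auto simp: g_def Func_def)
  then have "e g \<in> Field \<kappa>" using e(2) by blast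
  then obtain b where b: "b \<in> K" "(e g, b) \<in> \<kappa>" using K(2) unfolding cofinal_def by blast
  have "d (e g) = g" unfolding d_def using e(1) gF by (rule the_inv_into_f_f)
  moreover have "e g \<in> under \<kappa> b" using b by (simp add: under_def)
  ultimately show False using g0[OF b(1)] b(1) by (force simp: g_def)
qed

lemma UN_less:
  assumes "|I| <o \<kappa>" and "\<And>i. i \<in> I \<Longrightarrow> |A i| <o \<kappa>"
  shows "|\<Union>i\<in>I. A i| <o \<kappa>"
  using stable_UNION[OF regularCard_stable[OF \<kappa>_card \<kappa>_infinite regular] assms(1)] assms(2) by blast

lemma Un_less: "|A| <o \<kappa> \<Longrightarrow> |B| <o \<kappa> \<Longrightarrow> |A \<union> B| <o \<kappa>"
  using card_of_Un_ordLess_infinite_Field[OF \<kappa>_infinite \<kappa>_card] by blast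

lemma finite_less: "finite A \<Longrightarrow> |A| <o \<kappa>"
  using finite_ordLess_infinite[of "|A|" \<kappa>] \<kappa>_infinite \<kappa>_wo
  by (simp add: Field_card_of card_of_well_order_on wo_rel_def)

lemma finite_le: "finite A \<Longrightarrow> |A| \<le>o \<kappa>"
  using finite_less ordLess_imp_ordLeq by blast

lemma subset_less: "A \<subseteq> B \<Longrightarrow> |B| <o \<kappa> \<Longrightarrow> |A| <o \<kappa>"
  using card_of_mono1 ordLeq_ordLess_trans by blast

lemma image_less: "|A| <o \<kappa> \<Longrightarrow> |f ` A| <o \<kappa>"
  using card_of_image ordLeq_ordLess_trans by blast

lemma inj_less:
  assumes "inj_on f A" "f ` A \<subseteq> B" "|B| <o \<kappa>"
  shows "|A| <o \<kappa>"
  using assms card_of_ordLeq[of A B] ordLeq_ordLess_trans by blast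

lemma Times_less: "|A| <o \<kappa> \<Longrightarrow> |B| <o \<kappa> \<Longrightarrow> |A \<times> B| <o \<kappa>"
proof -
  assume "|A| <o \<kappa>" "|B| <o \<kappa>"
  then have "|\<Union>a\<in>A. Pair a ` B| <o \<kappa>" by (intro UN_less image_less)
  moreover have "(\<Union>a\<in>A. Pair a ` B) = A \<times> B" by auto
  ultimately show ?thesis by simp
qed

lemma Times_le: "|A| \<le>o \<kappa> \<Longrightarrow> |B| \<le>o \<kappa> \<Longrightarrow> |A \<times> B| \<le>o \<kappa>"
  using card_of_Times_ordLeq_infinite_Field[OF \<kappa>_infinite _ _ \<kappa>_card] by blast

lemma UN_le:
  assumes "|I| \<le>o \<kappa>" and "\<And>i. i \<in> I \<Longrightarrow> |A i| \<le>o \<kappa>"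
  shows "|\<Union>i\<in>I. A i| \<le>o \<kappa>"
  using card_of_UNION_ordLeq_infinite_Field[OF \<kappa>_infinite \<kappa>_card assms(1)] assms(2) by blast

text \<open>Every nonempty or empty small subset is the range of a sequence of length below
  \<kappa>, so the sequences counted by \<open>cexp_less\<close> map onto the small subsets.\<close>

lemma small_subsets_le:
  assumes "|A| \<le>o \<kappa>"
  shows "|{s. s \<subseteq> A \<and> |s| <o \<kappa>}| \<le>o \<kappa>"
proof (cases "A = {}")
  case True
  then have "{s. s \<subseteq> A \<and> |s| <o \<kappa>} \<subseteq> {{}}" by auto
  then have "finite {s. s \<subseteq> A \<and> |s| <o \<kappa>}" by (rule finite_subset) simp
  then show ?thesis by (rule finite_le)
next
  case False
  obtain e where e: "inj_on e A" "e ` A \<subseteq> Field \<kappa>" using le_\<kappa>_inj[OF assms] .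
  define P where "P = (SIGMA \<sigma> : Field \<kappa>. Func (underS \<kappa> \<sigma>) (Field \<kappa>))"
  define D where "D = (\<lambda>(\<sigma>, f). the_inv_into A e ` f ` underS \<kappa> \<sigma>)"
  have "s \<in> D ` P" if s: "s \<subseteq> A" "|s| <o \<kappa>" for s
  proof -
    obtain \<sigma> g where \<sigma>: "\<sigma> \<in> Field \<kappa>" and g: "bij_betw g (underS \<kappa> \<sigma>) s"
      using ordLess_card_bij_underS[OF \<kappa>_card s(2)] .
    define f where "f = (\<lambda>x. if x \<in> underS \<kappa> \<sigma> then e (g x) else undefined)"
    have "(\<sigma>, f) \<in> P" using \<sigma> g s(1) e(2) by (fastforce simp: P_def f_def Func_def bij_betw_def)
    moreover have "D (\<sigma>, f) = s"
    proof -
      have "f ` underS \<kappa> \<sigma> = e ` s"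
        using g by (auto simp: f_def bij_betw_def)
      moreover have "the_inv_into A e ` e ` s = s"
        using s(1) e(1) by (force simp: image_image the_inv_into_f_f subset_iff)
      ultimately show ?thesis by (simp add: D_def)
    qed
    ultimately show ?thesis by (metis imageI)
  qed
  then have "|{s. s \<subseteq> A \<and> |s| <o \<kappa>}| \<le>o |P|"
    by (intro surj_imp_ordLeq[of _ D]) blast
  also have "|P| = cexp_less \<kappa>" by (simp add: P_def cexp_less_def)
  finally show ?thesis using self_exp ordLeq_ordIso_trans by blast
qed

section \<open>The successor cardinal\<close>

lemma underS_le: "|underS \<kappa>S x| \<le>o \<kappa>"
proof (cases "x \<in> Field \<kappa>S")
  case True
  then show ?thesis using card_of_underS[OF \<kappa>S_card] less_\<kappa>S_iff by blast
next
  case False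
  then have "underS \<kappa>S x = {}" by (auto simp: underS_def Field_def)
  then show ?thesis by (simp add: finite_le)
qed

lemma lt_Field: "x \<in> underS \<kappa>S y \<Longrightarrow> x \<in> Field \<kappa>S" "x \<in> underS \<kappa>S y \<Longrightarrow> y \<in> Field \<kappa>S"
  by (auto simp: underS_def Field_def)

lemma lt_trans: "x \<in> underS \<kappa>S y \<Longrightarrow> y \<in> underS \<kappa>S z \<Longrightarrow> x \<in> underS \<kappa>S z"
  using wo_rel.TRANS[OF \<kappa>S_wo] wo_rel.ANTISYM[OF \<kappa>S_wo]
  by (auto simp: underS_def dest: transD antisymD)

lemma lt_irrefl: "x \<notin> underS \<kappa>S x"
  by (simp add: underS_def)

lemma lt_linear:
  "x \<in> Field \<kappa>S \<Longrightarrow> y \<in> Field \<kappa>S \<Longrightarrow> x \<in> underS \<kappa>S y \<or> x = y \<or> y \<in> underS \<kappa>S x"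
  using wo_rel.TOTALS[OF \<kappa>S_wo] by (auto simp: underS_def)

text \<open>Regularity of \<open>\<kappa>S\<close>: \<open>A\<close> together with all segments
  below its members has size at most \<kappa>, and any point outside lies above all of
  \<open>A\<close>.\<close>

lemma le_\<kappa>_bounded:
  assumes "A \<subseteq> Field \<kappa>S" "|A| \<le>o \<kappa>"
  obtains b where "b \<in> Field \<kappa>S" "A \<subseteq> underS \<kappa>S b"
proof -
  let ?U = "\<Union>a\<in>A. underS \<kappa>S a"
  have "|A| <o \<kappa>S" "|?U| <o \<kappa>S"
    using assms(2) UN_le[OF assms(2) underS_le] by (simp_all add: less_\<kappa>S_iff)
  then have "|A \<union> ?U| <o \<kappa>S"
    using card_of_Un_ordLess_infinite_Field[OF \<kappa>S_infinite \<kappa>S_card] by blast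
  then have "\<not> Field \<kappa>S \<subseteq> A \<union> ?U"
    using ordLeq_ordLess_trans[OF card_of_mono1] Field_\<kappa>S_iso not_ordLess_ordIso by metis
  then obtain b where "b \<in> Field \<kappa>S" "b \<notin> A" "b \<notin> ?U" by blast
  then have "A \<subseteq> underS \<kappa>S b" using lt_linear assms(1) by blast
  then show thesis using that \<open>b \<in> Field \<kappa>S\<close> by blast
qed

section \<open>Closed unbounded sets and cofinality\<close>

text \<open>For unboundedness, a point is closed off in \<omega> steps under \<open>G\<close> and
  under predecessors. The result has size at most \<kappa>, hence is a proper initial segment, and
  its end point is a closure point above the start.\<close>

lemma club_closure_points:
  assumes G: "\<And>x. x \<in> Field \<kappa>S \<Longrightarrow> G x \<in> Field \<kappa>S"
  shows "club \<kappa>S {\<delta> \<in> Field \<kappa>S. \<forall>x \<in> underS \<kappa>S \<delta>. G x \<in> underS \<kappa>S \<delta>}" (is "club _ ?D")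
  unfolding club_def
proof (intro conjI)
  show "cofinal ?D \<kappa>S"
    unfolding cofinal_def
  proof
    fix a assume a: "a \<in> Field \<kappa>S"
    define U where "U = rec_nat {a} (\<lambda>_ A. A \<union> G ` A \<union> (\<Union>x\<in>A. underS \<kappa>S x))"
    have U0: "U 0 = {a}" and US: "U (Suc n) = U n \<union> G ` U n \<union> (\<Union>x\<in>U n. underS \<kappa>S x)" for n
      by (simp_all add: U_def)
    have UF: "U n \<subseteq> Field \<kappa>S" for n
      by (induction n) (use a G lt_Field in \<open>auto simp: U0 US\<close>)
    have Ule: "|U n| \<le>o \<kappa>" for n
    proof (induction n)
      case 0
      show ?case by (simp add: U0 finite_le)
    next
      case (Suc n)
      have "|G ` U n| \<le>o \<kappa>" using Suc card_of_image ordLeq_transitive by blast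
      moreover have "|\<Union>x\<in>U n. underS \<kappa>S x| \<le>o \<kappa>" using UN_le[OF Suc underS_le] .
      ultimately show ?case unfolding US
        using Suc card_of_Un_ordLeq_infinite_Field[OF \<kappa>_infinite] \<kappa>_card by blast
    qed
    have "|UNIV :: nat set| \<le>o \<kappa>"
      using \<kappa>_infinite Field_\<kappa>_iso infinite_iff_card_of_nat ordLeq_ordIso_trans by blast
    then have "|\<Union>n. U n| \<le>o \<kappa>" using UN_le Ule by blast
    then have ne: "(\<Union>n. U n) \<noteq> Field \<kappa>S"
      using less_\<kappa>S_iff[of "\<Union>n. U n"] Field_\<kappa>S_iso not_ordLess_ordIso[of "|Field \<kappa>S|" \<kappa>S] by auto
    have "ofilter \<kappa>S (\<Union>n. U n)"
      unfolding ofilter_def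
    proof (intro conjI ballI subsetI)
      fix x assume "x \<in> (\<Union>n. U n)" then show "x \<in> Field \<kappa>S" using UF by blast
    next
      fix x y assume x: "x \<in> (\<Union>n. U n)" and y: "y \<in> under \<kappa>S x"
      obtain n where n: "x \<in> U n" using x by blast
      have "y = x \<or> y \<in> underS \<kappa>S x" using y by (auto simp: under_def underS_def)
      then have "y \<in> U (Suc n)" using n by (auto simp: US)
      then show "y \<in> (\<Union>n. U n)" by blast
    qed
    then have "\<exists>b\<in>Field \<kappa>S. (\<Union>n. U n) = underS \<kappa>S b"
      using ne by (simp add: wo_rel.ofilter_underS_Field[OF \<kappa>S_wo])
    then obtain b where b: "b \<in> Field \<kappa>S" "(\<Union>n. U n) = underS \<kappa>S b" ..
    have "a \<in> U 0" by (simp add: U0)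
    then have "a \<in> underS \<kappa>S b" unfolding b(2)[symmetric] by (rule UN_I[OF UNIV_I])
    moreover have "G x \<in> underS \<kappa>S b" if x: "x \<in> underS \<kappa>S b" for x
    proof -
      obtain n where "x \<in> U n" using x unfolding b(2)[symmetric] by blast
      then have "G x \<in> U (Suc n)" by (auto simp: US)
      then show ?thesis unfolding b(2)[symmetric] by blast
    qed
    ultimately show "\<exists>b\<in>?D. a \<noteq> b \<and> (a, b) \<in> \<kappa>S" using b(1) by (auto simp: underS_def)
  qed
  show "closed_in_ord \<kappa>S ?D"
    unfolding closed_in_ord_def
  proof (intro ballI impI, elim conjE)
    fix \<delta> assume \<delta>: "\<delta> \<in> Field \<kappa>S"
      and lim: "\<forall>\<alpha>\<in>underS \<kappa>S \<delta>. \<exists>\<gamma>\<in>?D \<inter> underS \<kappa>S \<delta>. \<alpha> \<in> underS \<kappa>S \<gamma>"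
    have "G x \<in> underS \<kappa>S \<delta>" if "x \<in> underS \<kappa>S \<delta>" for x
      using lim that lt_trans by blast
    then show "\<delta> \<in> ?D" using \<delta> by blast
  qed
qed auto

text \<open>The closed segments below the members of a weakly cofinal set cover \<kappa>, and each
  has size below \<kappa>; regularity forbids fewer than \<kappa> of them.\<close>

lemma cof_\<kappa>: "\<kappa> \<le>o cof \<kappa>"
proof -
  obtain A where A: "weakly_cofinal \<kappa> A" "cof \<kappa> = |A|"
    using cof_witness[of \<kappa>] \<kappa>_wo by (auto simp: wo_rel_def)
  have "\<not> |A| <o \<kappa>"
  proof
    assume "|A| <o \<kappa>"
    moreover have "|under \<kappa> a| <o \<kappa>" if "a \<in> A" for a
      using that A(1) under_less by (auto simp: weakly_cofinal_def)
    ultimately have "|\<Union>a\<in>A. under \<kappa> a| <o \<kappa>" by (rule UN_less)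
    then obtain x where "x \<in> Field \<kappa>" "x \<notin> (\<Union>a\<in>A. under \<kappa> a)"
      using less_\<kappa>_exists_not_in by blast
    then show False using A(1) by (auto simp: weakly_cofinal_def under_def)
  qed
  then show ?thesis
    using A(2) \<kappa>_wo by (simp add: not_ordLess_iff_ordLeq card_of_Well_order wo_rel_def)
qed

text \<open>The cofinality of \<delta> is at least \<kappa>, so \<open>A\<close> is too small to be
  weakly cofinal below \<delta>. A witness \<epsilon> of this failure is above or incomparable to
  each member of \<open>A\<close>, and linearity puts all of \<open>A\<close> strictly below
  it.\<close>

lemma cof_point_bounded:
  assumes \<delta>: "\<delta> \<in> cof_points \<kappa>S (cof \<kappa>)" and A: "A \<subseteq> underS \<kappa>S \<delta>" "|A| <o \<kappa>"
  obtains \<epsilon> where "\<epsilon> \<in> underS \<kappa>S \<delta>" "A \<subseteq> underS \<kappa>S \<epsilon>"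
proof -
  let ?R = "Restr \<kappa>S (underS \<kappa>S \<delta>)"
  have wo: "Well_order \<kappa>S" using \<kappa>S_wo by (simp add: wo_rel_def)
  have "Well_order ?R" using wo Well_order_Restr by blast
  then obtain B where B: "cof ?R = |B|" "\<And>C. weakly_cofinal ?R C \<Longrightarrow> |B| \<le>o |C|"
    using cof_witness by blast
  have "|B| =o cof \<kappa>" using \<delta> B(1) by (simp add: cof_points_def)
  then have "\<kappa> \<le>o |B|" using cof_\<kappa> ordIso_symmetric ordLeq_ordIso_trans by blast
  then have "\<not> |B| \<le>o |A|"
    using A(2) not_ordLess_ordLeq ordLeq_transitive by blast
  then have nc: "\<not> weakly_cofinal ?R A" using B(2) by blast
  have F: "Field ?R = underS \<kappa>S \<delta>"
    by (simp add: Field_Restr_ofilter wo wo_rel.underS_ofilter \<kappa>S_wo)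
  obtain \<epsilon> where \<epsilon>: "\<epsilon> \<in> underS \<kappa>S \<delta>" "\<forall>a\<in>A. (\<epsilon>, a) \<notin> ?R"
    using nc A(1) unfolding weakly_cofinal_def F by blast
  have "a \<in> underS \<kappa>S \<epsilon>" if "a \<in> A" for a
  proof -
    have "(\<epsilon>, a) \<notin> \<kappa>S" using that \<epsilon> A(1) by blast
    moreover have "a \<in> Field \<kappa>S" "\<epsilon> \<in> Field \<kappa>S" using that A(1) \<epsilon>(1) lt_Field by blast+
    ultimately show ?thesis
      using lt_linear[of a \<epsilon>] wo_rel.REFL[OF \<kappa>S_wo] by (auto simp: underS_def refl_on_def)
  qed
  then show thesis using that \<epsilon>(1) by blast
qed

end

section \<open>Posets of small sets under reverse inclusion\<close>

definition incl :: "'q set set \<Rightarrow> 'q set rel" where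
  "incl Q = {(s, t). s \<in> Q \<and> t \<in> Q \<and> t \<subseteq> s}"

lemma poset_incl: "Q \<noteq> {} \<Longrightarrow> poset Q (incl Q)"
  by (auto simp: poset_def incl_def order_on_defs refl_on_def trans_def antisym_def)

text \<open>By directedness. It brings finitely many facts about the union of a filter into a single
  condition.\<close>

lemma filter_incl_finite_subset:
  assumes G: "filter_on Q (incl Q) G" and "finite t" "t \<subseteq> \<Union>G"
  shows "\<exists>s\<in>G. t \<subseteq> s"
  using assms(2,3)
proof (induction t rule: finite_induct)
  case empty
  then show ?case using G by (auto simp: filter_on_def)
next
  case (insert x t)
  then obtain s u where "s \<in> G" "t \<subseteq> s" "u \<in> G" "x \<in> u" by auto
  then obtain v where "v \<in> G" "(v, s) \<in> incl Q" "(v, u) \<in> incl Q"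
    using G unfolding filter_on_def by meson
  then show ?case using \<open>t \<subseteq> s\<close> \<open>x \<in> u\<close> unfolding incl_def by blast
qed

context self_exp
begin

text \<open>By \<open>fin\<close>, membership of a small set in \<open>Q\<close> is decided by its
  finite subsets. Hence the union of two compatible conditions, or of a short decreasing sequence,
  is a condition, and unions are greatest lower bounds under reverse inclusion.\<close>

lemma
  assumes ne: "Q \<noteq> {}" and small: "\<And>s. s \<in> Q \<Longrightarrow> |s| <o \<kappa>"
    and fin: "\<And>s. |s| <o \<kappa> \<Longrightarrow> (\<And>t. finite t \<Longrightarrow> t \<subseteq> s \<Longrightarrow> \<exists>u\<in>Q. t \<subseteq> u) \<Longrightarrow> s \<in> Q"
  shows well_met_incl: "well_met Q (incl Q)" and seq_glbs_incl: "seq_glbs \<kappa> Q (incl Q)"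
proof -
  show "well_met Q (incl Q)"
    unfolding well_met_def
  proof (intro ballI impI)
    fix q r assume q: "q \<in> Q" and r: "r \<in> Q" and c: "compatible Q (incl Q) q r"
    then obtain u where "u \<in> Q" "q \<union> r \<subseteq> u" by (auto simp: compatible_def incl_def)
    then have "q \<union> r \<in> Q"
      using small q r by (intro fin Un_less) blast+
    then show "\<exists>g. is_glb Q (incl Q) {q, r} g"
      using q r by (intro exI[of _ "q \<union> r"]) (auto simp: is_glb_def incl_def)
  qed
  show "seq_glbs \<kappa> Q (incl Q)"
    unfolding seq_glbs_def
  proof (intro ballI impI)
    fix \<sigma> s
    assume \<sigma>: "\<sigma> \<in> Field \<kappa>" and s: "s \<in> underS \<kappa> \<sigma> \<rightarrow> Q"
      and dec: "\<forall>\<beta>\<in>underS \<kappa> \<sigma>. \<forall>\<alpha>\<in>underS \<kappa> \<beta>. (s \<beta>, s \<alpha>) \<in> incl Q"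
    let ?U = "\<Union>\<beta>\<in>underS \<kappa> \<sigma>. s \<beta>"
    have "s \<beta> \<subseteq> s \<alpha> \<or> s \<alpha> \<subseteq> s \<beta>" if ab: "\<alpha> \<in> underS \<kappa> \<sigma>" "\<beta> \<in> underS \<kappa> \<sigma>" for \<alpha> \<beta>
    proof -
      have "\<alpha> \<in> Field \<kappa>" "\<beta> \<in> Field \<kappa>" using ab by (auto simp: underS_def Field_def)
      then have "\<alpha> = \<beta> \<or> \<alpha> \<in> underS \<kappa> \<beta> \<or> \<beta> \<in> underS \<kappa> \<alpha>"
        using wo_rel.TOTALS[OF \<kappa>_wo] by (auto simp: underS_def)
      then show ?thesis using dec ab by (auto simp: incl_def)
    qed
    then have chain: "subset.chain UNIV (s ` underS \<kappa> \<sigma>)" by (auto simp: subset_chain_def)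
    have "|?U| <o \<kappa>"
      using s small by (intro UN_less card_of_underS[OF \<kappa>_card \<sigma>]) auto
    moreover have "\<exists>u\<in>Q. t \<subseteq> u" if t: "finite t" "t \<subseteq> ?U" for t
    proof (cases "t = {}")
      \<comment> \<open>The sequence may have length zero, and then no member of it can contain
        \<open>t\<close>.\<close>
      case True
      then show ?thesis using ne by auto
    next
      case False
      then have "s ` underS \<kappa> \<sigma> \<noteq> {}" using t by auto
      then obtain u where "u \<in> s ` underS \<kappa> \<sigma>" "t \<subseteq> u"
        using finite_subset_Union_chain[OF t(1) _ _ chain] t(2) by blast
      then show ?thesis using s by blast
    qed
    ultimately have U: "?U \<in> Q" by (rule fin)
    have "is_glb Q (incl Q) (s ` underS \<kappa> \<sigma>) ?U"
      using U s by (auto simp: is_glb_def incl_def Pi_iff)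
    then show "\<exists>g. is_glb Q (incl Q) (s ` underS \<kappa> \<sigma>) g" ..
  qed
qed

text \<open>With at most \<kappa> conditions, their codes have a common bound \<open>b\<close> in
  \<open>\<kappa>S\<close>. Above \<open>b\<close> the code of \<open>q \<delta>\<close> is
  regressive, and equal codes mean equal conditions.\<close>

lemma stationary_cc_le:
  assumes le: "|Q| \<le>o \<kappa>" and po: "poset Q le"
  shows "stationary_cc \<kappa> Q le"
  unfolding stationary_cc_def
proof
  fix q assume q: "q \<in> Field \<kappa>S \<rightarrow> Q"
  let ?E = "cof_points \<kappa>S (cof \<kappa>)"
  have "|Q| \<le>o \<kappa>S" using le by (simp add: ordLess_imp_ordLeq flip: less_\<kappa>S_iff)
  then obtain e where e: "inj_on e Q" "e ` Q \<subseteq> Field \<kappa>S" by (rule le_\<kappa>S_inj)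
  have "|e ` Q| \<le>o \<kappa>" using le card_of_image ordLeq_transitive by blast
  then obtain b where b: "b \<in> Field \<kappa>S" "e ` Q \<subseteq> underS \<kappa>S b" by (rule le_\<kappa>_bounded[OF e(2)])
  let ?D = "{\<delta> \<in> Field \<kappa>S. \<forall>x \<in> underS \<kappa>S \<delta>. b \<in> underS \<kappa>S \<delta>}"
  have "club \<kappa>S ?D" by (rule club_closure_points) (rule b(1))
  moreover have "e (q \<delta>) \<in> underS \<kappa>S \<delta>" if \<delta>: "\<delta> \<in> ?D \<inter> ?E" for \<delta>
  proof -
    \<comment> \<open>The least point is in \<open>?D\<close> vacuously. The cofinality of \<delta>
      rules it out, since even the empty set must have a bound below \<delta>.\<close>
    have "\<delta> \<in> ?E" using \<delta> by blast
    then obtain \<epsilon> where "\<epsilon> \<in> underS \<kappa>S \<delta>"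
      by (rule cof_point_bounded[of \<delta> "{}"]) (auto simp: finite_less)
    then have "b \<in> underS \<kappa>S \<delta>" using \<delta> by blast
    moreover have "e (q \<delta>) \<in> underS \<kappa>S b" using b(2) q \<delta> by blast
    ultimately show ?thesis using lt_trans by blast
  qed
  moreover have "compatible Q le (q \<gamma>) (q \<delta>)"
    if "\<gamma> \<in> ?D \<inter> ?E" "\<delta> \<in> ?D \<inter> ?E" "e (q \<gamma>) = e (q \<delta>)" for \<gamma> \<delta>
  proof -
    have "q \<gamma> \<in> Q" "q \<delta> \<in> Q" using q that by auto
    moreover from this have "q \<gamma> = q \<delta>" using e(1) that(3) by (auto dest: inj_onD)
    ultimately show ?thesis
      using po by (auto simp: compatible_def poset_def order_on_defs refl_on_def)
  qed
  ultimately show "\<exists>D h. club \<kappa>S D \<and> (\<forall>\<delta>\<in>D \<inter> ?E. h \<delta> \<in> underS \<kappa>S \<delta>) \<and>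
      (\<forall>\<gamma>\<in>D \<inter> ?E. \<forall>\<delta>\<in>D \<inter> ?E. h \<gamma> = h \<delta> \<longrightarrow> compatible Q le (q \<gamma>) (q \<delta>))"
    by (intro exI[of _ ?D] exI[of _ "\<lambda>\<delta>. e (q \<delta>)"]) blast
qed

section \<open>Under the axiom, \<open>\<kappa>S\<close> is smaller than the power set of
  \<kappa>\<close>

lemma cexp_\<kappa>: "|Pow (Field \<kappa>)| =o ctwo ^c \<kappa>"
  using card_of_Pow_Func[of "Field \<kappa>"] by (simp add: cexp_def ctwo_def Field_card_of)

text \<open>
  If \<open>2\<^bsup>\<kappa>\<^esup> = \<kappa>\<^sup>+\<close>, then \<open>\<kappa>\<^sup>+\<close> dense sets suffice to make a Cohen subset of \<open>\<kappa>\<close> different from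
  every subset of \<open>\<kappa>\<close>.
\<close>

lemma GMA_cardSuc_less_cexp:
  assumes "GMA \<kappa>"
  shows "\<kappa>S <o ctwo ^c \<kappa>"
proof (rule ccontr)
  assume neg: "\<not> \<kappa>S <o ctwo ^c \<kappa>"
  have wo: "Well_order (ctwo ^c \<kappa>)" "Well_order \<kappa>S"
    using Card_order_cexp \<kappa>S_card card_order_on_well_order_on by blast+
  then have "ctwo ^c \<kappa> \<le>o \<kappa>S"
    using neg not_ordLess_iff_ordLeq by blast
  then have "|Pow (Field \<kappa>)| \<le>o |Field \<kappa>S|"
    using cexp_\<kappa> Field_\<kappa>S_iso ordIso_ordLeq_trans ordLeq_ordIso_trans ordIso_symmetric by meson
  then obtain Y where Y: "Y ` Field \<kappa>S = Pow (Field \<kappa>)"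
    using card_of_ordLeq2[of "Pow (Field \<kappa>)" "Field \<kappa>S"] by auto
  \<comment> \<open>Cohen forcing, with conditions as graphs of partial functions to truth values.
    It has at most \<kappa> members, which yields both the size bound and the chain
    condition.\<close>
  define Q where "Q = {s. s \<subseteq> Field \<kappa> \<times> (UNIV :: bool set) \<and> |s| <o \<kappa> \<and> single_valued s}"
  have "{} \<in> Q" using finite_less[of "{}"] by (simp add: Q_def)
  then have ne: "Q \<noteq> {}" by blast
  have small: "|s| <o \<kappa>" if "s \<in> Q" for s using that by (simp add: Q_def)
  have fin: "s \<in> Q" if s: "|s| <o \<kappa>" "\<And>t. finite t \<Longrightarrow> t \<subseteq> s \<Longrightarrow> \<exists>u\<in>Q. t \<subseteq> u" for s
  proof -
    have "s \<subseteq> Field \<kappa> \<times> UNIV"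
    proof
      fix x assume "x \<in> s"
      then show "x \<in> Field \<kappa> \<times> UNIV" using s(2)[of "{x}"] by (auto simp: Q_def)
    qed
    moreover have "single_valued s"
    proof (rule single_valuedI)
      fix x y z assume "(x, y) \<in> s" "(x, z) \<in> s"
      then obtain u where "u \<in> Q" "(x, y) \<in> u" "(x, z) \<in> u" using s(2)[of "{(x, y), (x, z)}"] by auto
      then show "y = z" by (auto simp: Q_def dest: single_valuedD)
    qed
    ultimately show ?thesis using s(1) by (simp add: Q_def)
  qed
  have "|Field \<kappa> \<times> (UNIV :: bool set)| \<le>o \<kappa>"
    by (intro Times_le ordIso_imp_ordLeq[OF Field_\<kappa>_iso] finite_le finite_class.finite_UNIV)
  then have "|{s. s \<subseteq> Field \<kappa> \<times> (UNIV :: bool set) \<and> |s| <o \<kappa>}| \<le>o \<kappa>"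
    by (rule small_subsets_le)
  then have Qle: "|Q| \<le>o \<kappa>"
    by (rule ordLeq_transitive[OF card_of_mono1, rotated]) (auto simp: Q_def)
  have "GMA_poset \<kappa> Q (incl Q)"
    unfolding GMA_poset_def
    using poset_incl[OF ne] well_met_incl[OF ne small fin] seq_glbs_incl[OF ne small fin]
      stationary_cc_le[OF Qle poset_incl[OF ne]]
      ordLeq_ordLess_trans[OF Qle ordLess_ctwo_cexp[OF \<kappa>_card]] by blast
  \<comment> \<open>Such a condition decides against \<open>Y \<beta>\<close> at some point. Density
    holds because every condition leaves points undecided.\<close>
  moreover define D where "D \<beta> = {q \<in> Q. \<exists>x. (x, x \<notin> Y \<beta>) \<in> q}" for \<beta>
  moreover have "dense_in Q (incl Q) (D \<beta>)" for \<beta>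
    unfolding dense_in_def
  proof (intro conjI ballI)
    fix q assume q: "q \<in> Q"
    have "|Domain q| <o \<kappa>" using image_less[OF small[OF q], of fst] by (simp add: Domain_fst)
    then obtain x where x: "x \<in> Field \<kappa>" "x \<notin> Domain q" by (rule less_\<kappa>_exists_not_in)
    have "insert (x, x \<notin> Y \<beta>) q \<in> Q"
      using q x Un_less[of "{(x, x \<notin> Y \<beta>)}" q] finite_less[of "{(x, x \<notin> Y \<beta>)}"]
      by (auto simp: Q_def single_valued_def)
    then show "\<exists>d\<in>D \<beta>. (d, q) \<in> incl Q" using q by (auto simp: D_def incl_def)
  qed (auto simp: D_def)
  ultimately obtain G where G: "filter_on Q (incl Q) G" "\<forall>\<beta>\<in>Field \<kappa>S. G \<inter> D \<beta> \<noteq> {}"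
    using GMA_any_type[OF assms, of Q "incl Q" D] by blast
  \<comment> \<open>The generic set occurs in the list \<open>Y\<close>, say at \<beta>, although
    the filter meets \<open>D \<beta>\<close>.\<close>
  have "{x \<in> Field \<kappa>. (x, True) \<in> \<Union>G} \<in> Y ` Field \<kappa>S" unfolding Y by blast
  then obtain \<beta> where \<beta>: "\<beta> \<in> Field \<kappa>S" "Y \<beta> = {x \<in> Field \<kappa>. (x, True) \<in> \<Union>G}" by auto
  obtain q x where q: "q \<in> G" "q \<in> Q" "(x, x \<notin> Y \<beta>) \<in> q"
    using G(2)[rule_format, OF \<beta>(1)] unfolding D_def by blast
  have "x \<in> Field \<kappa>" using q by (auto simp: Q_def)
  show False
  proof (cases "x \<in> Y \<beta>")
    case True
    then have "{(x, True), (x, False)} \<subseteq> \<Union>G" using \<beta> q by auto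
    then obtain s where s: "s \<in> G" "{(x, True), (x, False)} \<subseteq> s"
      using filter_incl_finite_subset[OF G(1), of "{(x, True), (x, False)}"] by auto
    then have "s \<in> Q" using G(1) by (auto simp: filter_on_def)
    then show False using s(2) by (auto simp: Q_def single_valued_def)
  next
    case False
    then show False using \<beta>(2) q \<open>x \<in> Field \<kappa>\<close> by auto
  qed
qed

section \<open>The partition\<close>

text \<open>Partial functions are represented by their graphs, so that extension is inclusion. They
  serve both as patterns for a column of the partition and as the sets from which conditions are
  taken.\<close>

definition pfuns :: "('a set \<times> 'a) set set" where
  "pfuns = {g. g \<subseteq> Field \<kappa>S \<times> Field \<kappa> \<and> |g| <o \<kappa> \<and> single_valued g}"

lemma Domain_less: "|g| <o \<kappa> \<Longrightarrow> |Domain g| <o \<kappa>"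
  using image_less[of g fst] by (simp add: Domain_fst)

lemma Range_less: "|g| <o \<kappa> \<Longrightarrow> |Range g| <o \<kappa>"
  using image_less[of g snd] by (simp add: Range_snd)

text \<open>The domain is bounded by some \<epsilon> in \<open>\<kappa>S\<close>, and there are at
  most \<kappa> small sets of pairs below each \<epsilon>.\<close>

lemma pfuns_le: "|pfuns| \<le>o \<kappa>S"
proof -
  define A where "A \<epsilon> = {g. g \<subseteq> underS \<kappa>S \<epsilon> \<times> Field \<kappa> \<and> |g| <o \<kappa>}" for \<epsilon>
  have "|A \<epsilon>| \<le>o \<kappa>S" for \<epsilon>
  proof -
    have "|A \<epsilon>| \<le>o \<kappa>"
      unfolding A_def
      by (intro small_subsets_le Times_le underS_le ordIso_imp_ordLeq[OF Field_\<kappa>_iso])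
    then show ?thesis by (simp add: ordLess_imp_ordLeq flip: less_\<kappa>S_iff)
  qed
  then have "|\<Union>\<epsilon>\<in>Field \<kappa>S. A \<epsilon>| \<le>o \<kappa>S"
    using card_of_UNION_ordLeq_infinite_Field[OF \<kappa>S_infinite \<kappa>S_card ordIso_imp_ordLeq[OF Field_\<kappa>S_iso]]
    by blast
  moreover have "pfuns \<subseteq> (\<Union>\<epsilon>\<in>Field \<kappa>S. A \<epsilon>)"
  proof
    fix g assume g: "g \<in> pfuns"
    have "Domain g \<subseteq> Field \<kappa>S" using g by (auto simp: pfuns_def)
    moreover have "|Domain g| \<le>o \<kappa>" using g Domain_less ordLess_imp_ordLeq by (auto simp: pfuns_def)
    ultimately obtain b where "b \<in> Field \<kappa>S" "Domain g \<subseteq> underS \<kappa>S b" by (rule le_\<kappa>_bounded)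
    moreover from this have "g \<subseteq> underS \<kappa>S b \<times> Field \<kappa>" using g by (auto simp: pfuns_def)
    ultimately show "g \<in> (\<Union>\<epsilon>\<in>Field \<kappa>S. A \<epsilon>)" using g by (auto simp: pfuns_def A_def)
  qed
  ultimately show ?thesis using card_of_mono1 ordLeq_transitive by blast
qed

text \<open>Each \<open>g\<close> gets one index for every element of \<open>\<kappa>S\<close>, more
  than fit below or at \<open>b\<close>. So every pattern recurs beyond any bound, in particular
  above its own domain.\<close>

lemma unbounded_enumeration:
  obtains gen where "\<And>\<beta>. gen \<beta> \<in> pfuns"
    "\<And>g b. g \<in> pfuns \<Longrightarrow> b \<in> Field \<kappa>S \<Longrightarrow> \<exists>\<beta>\<in>Field \<kappa>S. b \<in> underS \<kappa>S \<beta> \<and> gen \<beta> = g"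
proof -
  have "|pfuns \<times> Field \<kappa>S| \<le>o \<kappa>S"
    by (intro card_of_Times_ordLeq_infinite_Field[OF \<kappa>S_infinite pfuns_le _ \<kappa>S_card]
        ordIso_imp_ordLeq[OF Field_\<kappa>S_iso])
  then obtain e where e: "inj_on e (pfuns \<times> Field \<kappa>S)" "e ` (pfuns \<times> Field \<kappa>S) \<subseteq> Field \<kappa>S"
    by (rule le_\<kappa>S_inj)
  define gen where "gen \<beta> = (if \<beta> \<in> e ` (pfuns \<times> Field \<kappa>S)
    then fst (the_inv_into (pfuns \<times> Field \<kappa>S) e \<beta>) else {})" for \<beta>
  have empty: "{} \<in> pfuns" using finite_less[of "{}"] by (simp add: pfuns_def)
  have gen_e: "gen (e (g, x)) = g" if "g \<in> pfuns" "x \<in> Field \<kappa>S" for g x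
    using that e(1) by (auto simp: gen_def the_inv_into_f_f)
  have "gen \<beta> \<in> pfuns" for \<beta>
  proof (cases "\<beta> \<in> e ` (pfuns \<times> Field \<kappa>S)")
    case True
    then show ?thesis using gen_e by auto
  next
    case False
    then show ?thesis using empty by (simp add: gen_def)
  qed
  moreover have "\<exists>\<beta>\<in>Field \<kappa>S. b \<in> underS \<kappa>S \<beta> \<and> gen \<beta> = g" if g: "g \<in> pfuns" "b \<in> Field \<kappa>S" for g b
  proof (rule ccontr)
    assume neg: "\<not> ?thesis"
    have "e (g, x) \<in> insert b (underS \<kappa>S b)" if x: "x \<in> Field \<kappa>S" for x
    proof -
      have "e (g, x) \<in> Field \<kappa>S" using e(2) g(1) x by blast
      then show ?thesis using neg gen_e[OF g(1) x] lt_linear[of b "e (g, x)"] g(2) by blast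
    qed
    moreover have "inj_on (\<lambda>x. e (g, x)) (Field \<kappa>S)"
      using e(1) g(1) by (auto simp: inj_on_def)
    ultimately have "|Field \<kappa>S| \<le>o |{b} \<union> underS \<kappa>S b|"
      by (subst card_of_ordLeq[symmetric]) auto
    moreover have "|{b} \<union> underS \<kappa>S b| \<le>o \<kappa>"
      using card_of_Un_ordLeq_infinite_Field[OF \<kappa>_infinite finite_le underS_le, of "{b}" b] \<kappa>_card by simp
    ultimately have "|Field \<kappa>S| <o \<kappa>S"
      unfolding less_\<kappa>S_iff by (rule ordLeq_transitive)
    then show False using Field_\<kappa>S_iso not_ordLess_ordIso by blast
  qed
  ultimately show thesis by (rule that)
qed

text \<open>For \<beta> = \<beta>' these are the points at which one column fails to be injective;
  otherwise, those whose value also occurs in the other column.\<close>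

definition collisions :: "('a set \<times> 'a set \<Rightarrow> 'a) \<Rightarrow> 'a set \<Rightarrow> 'a set \<Rightarrow> 'a set set" where
  "collisions p \<beta> \<beta>' = {\<alpha> \<in> underS \<kappa>S \<beta>. \<exists>\<alpha>' \<in> underS \<kappa>S \<beta>'. (\<alpha>, \<beta>) \<noteq> (\<alpha>', \<beta>') \<and> p (\<alpha>, \<beta>) = p (\<alpha>', \<beta>')}"

text \<open>
  Off a small set, \<open>p(\<cdot>, \<beta>)\<close> is injective with values in the branch \<open>Y\<^sub>\<beta>\<close> of the tree \<open>2\<^bsup><\<kappa>\<^esup>\<close>,
  and distinct branches share fewer than \<open>\<kappa>\<close> nodes. The exceptional small sets serve to realise every
  small pattern of values.
\<close>

lemma exists_partition:
  obtains p where "p \<in> pairs \<kappa>S (Field \<kappa>S) \<rightarrow> Field \<kappa>"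
    "\<And>\<beta> \<beta>'. \<beta> \<in> Field \<kappa>S \<Longrightarrow> \<beta>' \<in> Field \<kappa>S \<Longrightarrow> |collisions p \<beta> \<beta>'| <o \<kappa>"
    "\<And>g. g \<in> pfuns \<Longrightarrow> \<exists>\<beta>\<in>Field \<kappa>S. Domain g \<subseteq> underS \<kappa>S \<beta> \<and> (\<forall>(\<gamma>, j)\<in>g. p (\<gamma>, \<beta>) = j)"
proof -
  obtain gen where gen: "\<And>\<beta>. gen \<beta> \<in> pfuns"
    "\<And>g b. g \<in> pfuns \<Longrightarrow> b \<in> Field \<kappa>S \<Longrightarrow> \<exists>\<beta>\<in>Field \<kappa>S. b \<in> underS \<kappa>S \<beta> \<and> gen \<beta> = g"
    by (rule unbounded_enumeration) blast
  \<comment> \<open>There are enough subsets of \<kappa> to give each column its own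
    \<open>Y \<beta>\<close>, read as a branch of the binary tree of height \<kappa>.\<close>
  have "\<kappa>S \<le>o |Pow (Field \<kappa>)|"
    using cardSuc_ordLess_ordLeq[OF \<kappa>_card card_of_Card_order] Card_order_Pow[OF \<kappa>_card] by blast
  then have "|Field \<kappa>S| \<le>o |Pow (Field \<kappa>)|"
    using Field_\<kappa>S_iso ordIso_ordLeq_trans by blast
  then obtain Y where Y: "inj_on Y (Field \<kappa>S)" "Y ` Field \<kappa>S \<subseteq> Pow (Field \<kappa>)"
    using card_of_ordLeq by metis
  have "\<exists>e. inj_on e (underS \<kappa>S \<beta>) \<and> e ` underS \<kappa>S \<beta> \<subseteq> Field \<kappa>" for \<beta>
    using le_\<kappa>_inj[OF underS_le] by metis
  then obtain e where e: "\<And>\<beta>. inj_on (e \<beta>) (underS \<kappa>S \<beta>)" "\<And>\<beta>. e \<beta> ` underS \<kappa>S \<beta> \<subseteq> Field \<kappa>"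
    by metis
  let ?N = "Field \<kappa> \<times> {s. s \<subseteq> Field \<kappa> \<and> |s| <o \<kappa>}"
  have "|?N| \<le>o \<kappa>"
    by (intro Times_le small_subsets_le ordIso_imp_ordLeq[OF Field_\<kappa>_iso])
  then obtain code where code: "inj_on code ?N" "code ` ?N \<subseteq> Field \<kappa>" by (rule le_\<kappa>_inj)
  \<comment> \<open>The node of the branch \<open>Y \<beta>\<close> at height
    \<open>e \<beta> \<alpha>\<close>. Recording the height keeps the nodes of one column
    distinct.\<close>
  define node where "node \<beta> \<alpha> = (e \<beta> \<alpha>, Y \<beta> \<inter> underS \<kappa> (e \<beta> \<alpha>))" for \<alpha> \<beta>
  have eF: "e \<beta> \<alpha> \<in> Field \<kappa>" if "\<alpha> \<in> underS \<kappa>S \<beta>" for \<alpha> \<beta>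
    using e(2) that by blast
  have node: "node \<beta> \<alpha> \<in> ?N" if "\<alpha> \<in> underS \<kappa>S \<beta>" for \<alpha> \<beta>
  proof -
    have "|Y \<beta> \<inter> underS \<kappa> (e \<beta> \<alpha>)| <o \<kappa>"
      using subset_less[OF _ card_of_underS[OF \<kappa>_card eF[OF that]]] by blast
    moreover have "Y \<beta> \<subseteq> Field \<kappa>" using Y(2) lt_Field[OF that] by blast
    ultimately show ?thesis using eF[OF that] by (auto simp: node_def)
  qed
  \<comment> \<open>The pattern \<open>gen \<beta>\<close> overrides the node codes on its small
    domain.\<close>
  define p where "p = (\<lambda>(\<alpha>, \<beta>). if \<alpha> \<in> Domain (gen \<beta>) then THE j. (\<alpha>, j) \<in> gen \<beta> else code (node \<beta> \<alpha>))"
  have p_gen: "p (\<alpha>, \<beta>) = j" if "(\<alpha>, j) \<in> gen \<beta>" for \<alpha> \<beta> j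
  proof -
    have "single_valued (gen \<beta>)" using gen(1) by (auto simp: pfuns_def)
    then have "(THE j. (\<alpha>, j) \<in> gen \<beta>) = j"
      using that by (intro the_equality) (auto dest: single_valuedD)
    then show ?thesis using that by (auto simp: p_def)
  qed
  have p_node: "p (\<alpha>, \<beta>) = code (node \<beta> \<alpha>)" if "\<alpha> \<notin> Domain (gen \<beta>)" for \<alpha> \<beta>
    using that by (simp add: p_def)
  have dom_small: "|Domain (gen \<beta>)| <o \<kappa>" for \<beta>
    using gen(1)[of \<beta>] Domain_less by (auto simp: pfuns_def)
  show thesis
  proof (rule that)
    show "p \<in> pairs \<kappa>S (Field \<kappa>S) \<rightarrow> Field \<kappa>"
    proof (rule Pi_I, clarify)
      fix \<alpha> \<beta> assume "(\<alpha>, \<beta>) \<in> pairs \<kappa>S (Field \<kappa>S)"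
      then have lt: "\<alpha> \<in> underS \<kappa>S \<beta>" by (simp add: pairs_def)
      show "p (\<alpha>, \<beta>) \<in> Field \<kappa>"
      proof (cases "\<alpha> \<in> Domain (gen \<beta>)")
        case True
        then obtain j where j: "(\<alpha>, j) \<in> gen \<beta>" by blast
        then have "j \<in> Field \<kappa>" using gen(1)[of \<beta>] by (auto simp: pfuns_def)
        then show ?thesis using p_gen[OF j] by simp
      next
        case False
        then show ?thesis
          unfolding p_node[OF False] by (intro subsetD[OF code(2)] imageI node[OF lt])
      qed
    qed
  next
    fix g assume g: "g \<in> pfuns"
    have "Domain g \<subseteq> Field \<kappa>S" using g by (auto simp: pfuns_def)
    moreover have "|Domain g| \<le>o \<kappa>" using g Domain_less ordLess_imp_ordLeq by (auto simp: pfuns_def)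
    ultimately obtain b where b: "b \<in> Field \<kappa>S" "Domain g \<subseteq> underS \<kappa>S b" by (rule le_\<kappa>_bounded)
    obtain \<beta> where "\<beta> \<in> Field \<kappa>S" "b \<in> underS \<kappa>S \<beta>" "gen \<beta> = g" using gen(2)[OF g b(1)] by blast
    moreover from this have "Domain g \<subseteq> underS \<kappa>S \<beta>" using b(2) lt_trans by blast
    ultimately show "\<exists>\<beta>\<in>Field \<kappa>S. Domain g \<subseteq> underS \<kappa>S \<beta> \<and> (\<forall>(\<gamma>, j)\<in>g. p (\<gamma>, \<beta>) = j)"
      using p_gen[where \<beta> = \<beta>] by (intro bexI[of _ \<beta>]) auto
  next
    fix \<beta> \<beta>' assume \<beta>: "\<beta> \<in> Field \<kappa>S" and \<beta>': "\<beta>' \<in> Field \<kappa>S"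
    \<comment> \<open>Collisions off the domain of \<open>gen \<beta>\<close> are of two sorts: in
      \<open>B\<close> the node code equals a pattern value of column \<beta>', in \<open>C\<close>
      two different pairs share a node.\<close>
    define B where "B = {\<alpha> \<in> underS \<kappa>S \<beta>. code (node \<beta> \<alpha>) \<in> (\<lambda>\<alpha>'. p (\<alpha>', \<beta>')) ` Domain (gen \<beta>')}"
    define C where "C = {\<alpha> \<in> underS \<kappa>S \<beta>. \<exists>\<alpha>' \<in> underS \<kappa>S \<beta>'. (\<alpha>, \<beta>) \<noteq> (\<alpha>', \<beta>') \<and> node \<beta> \<alpha> = node \<beta>' \<alpha>'}"
    have "inj_on (\<lambda>\<alpha>. code (node \<beta> \<alpha>)) (underS \<kappa>S \<beta>)"
    proof (rule inj_onI)
      fix x y assume xy: "x \<in> underS \<kappa>S \<beta>" "y \<in> underS \<kappa>S \<beta>" "code (node \<beta> x) = code (node \<beta> y)"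
      have "node \<beta> x = node \<beta> y" using inj_onD[OF code(1) xy(3)] node xy by blast
      then have "e \<beta> x = e \<beta> y" by (simp add: node_def)
      then show "x = y" using e(1) xy(1,2) by (auto dest: inj_onD)
    qed
    then have "inj_on (\<lambda>\<alpha>. code (node \<beta> \<alpha>)) B"
      by (rule inj_on_subset) (auto simp: B_def)
    then have "|B| <o \<kappa>"
      by (rule inj_less[OF _ _ image_less[OF dom_small]]) (auto simp: B_def)
    moreover have "|C| <o \<kappa>"
    proof (cases "\<beta> = \<beta>'")
      case True
      have "C = {}"
        using e(1)[of \<beta>] by (auto simp: C_def True node_def dest: inj_onD)
      then show ?thesis by (simp add: finite_less)
    next
      case False
      then have "Y \<beta> \<noteq> Y \<beta>'" using Y(1) \<beta> \<beta>' by (auto dest: inj_onD)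
      moreover have "Y \<beta> \<subseteq> Field \<kappa>" "Y \<beta>' \<subseteq> Field \<kappa>" using Y(2) \<beta> \<beta>' by blast+
      \<comment> \<open>The branches split at a point \<xi> where the two subsets differ, so a
        common node has height at most \<xi>.\<close>
      ultimately obtain \<xi> where \<xi>: "\<xi> \<in> Field \<kappa>" "\<xi> \<in> Y \<beta> \<longleftrightarrow> \<xi> \<notin> Y \<beta>'" by auto
      have "e \<beta> \<alpha> \<in> under \<kappa> \<xi>" if \<alpha>: "\<alpha> \<in> C" for \<alpha>
      proof -
        obtain \<alpha>' where a': "\<alpha> \<in> underS \<kappa>S \<beta>" "node \<beta> \<alpha> = node \<beta>' \<alpha>'" using \<alpha> by (auto simp: C_def)
        then have "Y \<beta> \<inter> underS \<kappa> (e \<beta> \<alpha>) = Y \<beta>' \<inter> underS \<kappa> (e \<beta> \<alpha>)"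
          unfolding node_def prod.inject by (elim conjE) (simp only:)
        then have "\<xi> \<notin> underS \<kappa> (e \<beta> \<alpha>)" using \<xi>(2) by blast
        moreover have "e \<beta> \<alpha> \<in> Field \<kappa>" using a'(1) by (rule eF)
        ultimately show ?thesis
          using wo_rel.TOTALS[OF \<kappa>_wo] wo_rel.REFL[OF \<kappa>_wo] \<xi>(1)
          by (auto simp: under_def underS_def refl_on_def)
      qed
      then have "e \<beta> ` C \<subseteq> under \<kappa> \<xi>" by blast
      moreover have "inj_on (e \<beta>) C" by (rule inj_on_subset[OF e(1)]) (auto simp: C_def)
      ultimately show ?thesis using inj_less under_less[OF \<xi>(1)] by blast
    qed
    ultimately have "|Domain (gen \<beta>) \<union> (B \<union> C)| <o \<kappa>" by (intro Un_less dom_small)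
    moreover have "collisions p \<beta> \<beta>' \<subseteq> Domain (gen \<beta>) \<union> (B \<union> C)"
    proof
      fix \<alpha> assume "\<alpha> \<in> collisions p \<beta> \<beta>'"
      then obtain \<alpha>' where a: "\<alpha> \<in> underS \<kappa>S \<beta>" "\<alpha>' \<in> underS \<kappa>S \<beta>'" "(\<alpha>, \<beta>) \<noteq> (\<alpha>', \<beta>')"
        "p (\<alpha>, \<beta>) = p (\<alpha>', \<beta>')" unfolding collisions_def by blast
      show "\<alpha> \<in> Domain (gen \<beta>) \<union> (B \<union> C)"
      proof (cases "\<alpha> \<in> Domain (gen \<beta>) \<or> \<alpha>' \<in> Domain (gen \<beta>')")
        case True
        then have "p (\<alpha>, \<beta>) \<in> (\<lambda>\<alpha>'. p (\<alpha>', \<beta>')) ` Domain (gen \<beta>')" if "\<alpha> \<notin> Domain (gen \<beta>)"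
          unfolding a(4) using that by blast
        then show ?thesis using a(1) p_node[of \<alpha> \<beta>] by (auto simp: B_def)
      next
        case False
        then have "code (node \<beta> \<alpha>) = code (node \<beta>' \<alpha>')" using a(4) p_node by metis
        then have "node \<beta> \<alpha> = node \<beta>' \<alpha>'" using inj_onD[OF code(1)] node a(1,2) by blast
        then show ?thesis using a by (auto simp: C_def)
      qed
    qed
    ultimately show "|collisions p \<beta> \<beta>'| <o \<kappa>" by (rule subset_less[rotated])
  qed
qed

end

section \<open>The forcing that homogenises a colouring over the partition\<close>

locale partition_colouring = self_exp +
  fixes p c :: "'a set \<times> 'a set \<Rightarrow> 'a"
  assumes p_range: "p \<in> pairs \<kappa>S (Field \<kappa>S) \<rightarrow> Field \<kappa>"
    and c_range: "c \<in> pairs \<kappa>S (Field \<kappa>S) \<rightarrow> Field \<kappa>"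
    and collisions_less: "\<And>\<beta> \<beta>'. \<beta> \<in> Field \<kappa>S \<Longrightarrow> \<beta>' \<in> Field \<kappa>S \<Longrightarrow> |collisions p \<beta> \<beta>'| <o \<kappa>"
    and pattern: "\<And>g. g \<in> pfuns \<Longrightarrow>
      \<exists>\<beta>\<in>Field \<kappa>S. Domain g \<subseteq> underS \<kappa>S \<beta> \<and> (\<forall>(\<gamma>, j)\<in>g. p (\<gamma>, \<beta>) = j)"
begin

text \<open>A pair \<open>(\<alpha>, i)\<close> in \<open>q\<close> is read as putting \<alpha> into
  cell \<open>i\<close>. The cells are homogeneous when cell and value of \<open>p\<close> determine
  the colour.\<close>

definition profile :: "('a set \<times> 'a) set \<Rightarrow> ('a \<times> 'a \<times> 'a) set" where
  "profile q = {(i, p (\<alpha>, \<beta>), c (\<alpha>, \<beta>)) | i \<alpha> \<beta>. (\<alpha>, i) \<in> q \<and> (\<beta>, i) \<in> q \<and> \<alpha> \<in> underS \<kappa>S \<beta>}"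

definition conds :: "('a set \<times> 'a) set set" where
  "conds = {q \<in> pfuns. \<forall>i j n n'. (i, j, n) \<in> profile q \<longrightarrow> (i, j, n') \<in> profile q \<longrightarrow> n = n'}"

lemma profileI:
  "(\<alpha>, i) \<in> q \<Longrightarrow> (\<beta>, i) \<in> q \<Longrightarrow> \<alpha> \<in> underS \<kappa>S \<beta> \<Longrightarrow> (i, p (\<alpha>, \<beta>), c (\<alpha>, \<beta>)) \<in> profile q"
  unfolding profile_def by blast

lemma profileE:
  assumes "(i, j, n) \<in> profile q"
  obtains \<alpha> \<beta> where "(\<alpha>, i) \<in> q" "(\<beta>, i) \<in> q" "\<alpha> \<in> underS \<kappa>S \<beta>" "j = p (\<alpha>, \<beta>)" "n = c (\<alpha>, \<beta>)"
  using assms unfolding profile_def by blast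

lemma profile_less:
  assumes "|q| <o \<kappa>"
  shows "|profile q| <o \<kappa>"
proof -
  have "profile q \<subseteq> (\<lambda>((\<alpha>, i), (\<beta>, _)). (i, p (\<alpha>, \<beta>), c (\<alpha>, \<beta>))) ` (q \<times> q)"
    by (force elim!: profileE)
  then show ?thesis using image_less[OF Times_less[OF assms assms]] by (rule subset_less)
qed

lemma p_c_Field: "\<alpha> \<in> underS \<kappa>S \<beta> \<Longrightarrow> p (\<alpha>, \<beta>) \<in> Field \<kappa> \<and> c (\<alpha>, \<beta>) \<in> Field \<kappa>"
  using p_range c_range lt_Field[of \<alpha> \<beta>] by (auto simp: pairs_def Pi_iff)

lemma profile_subset:
  assumes "q \<in> pfuns"
  shows "profile q \<subseteq> Field \<kappa> \<times> Field \<kappa> \<times> Field \<kappa>"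
proof
  fix x assume "x \<in> profile q"
  then show "x \<in> Field \<kappa> \<times> Field \<kappa> \<times> Field \<kappa>"
    using assms p_c_Field by (cases x) (auto simp: pfuns_def elim!: profileE)
qed

lemma conds_small: "q \<in> conds \<Longrightarrow> |q| <o \<kappa>"
  by (simp add: conds_def pfuns_def)

lemma empty_conds: "{} \<in> conds"
  using finite_less[of "{}"] by (auto simp: conds_def pfuns_def elim: profileE)

text \<open>Each requirement on a condition apart from its size can fail only through at most four
  elements of the graph, namely two pairs of points in one cell.\<close>

lemma conds_finitary:
  assumes s: "|s| <o \<kappa>" "\<And>t. finite t \<Longrightarrow> t \<subseteq> s \<Longrightarrow> \<exists>u\<in>conds. t \<subseteq> u"
  shows "s \<in> conds"
proof -
  have "s \<subseteq> Field \<kappa>S \<times> Field \<kappa>"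
  proof
    fix x assume "x \<in> s"
    then have "\<exists>u\<in>conds. {x} \<subseteq> u" by (intro s(2)) auto
    then show "x \<in> Field \<kappa>S \<times> Field \<kappa>" unfolding conds_def pfuns_def by blast
  qed
  moreover have "single_valued s"
  proof (rule single_valuedI)
    fix x y z assume "(x, y) \<in> s" "(x, z) \<in> s"
    then have "\<exists>u\<in>conds. {(x, y), (x, z)} \<subseteq> u" by (intro s(2)) auto
    then show "y = z" by (auto simp: conds_def pfuns_def dest: single_valuedD)
  qed
  moreover have "n = n'" if n: "(i, j, n) \<in> profile s" "(i, j, n') \<in> profile s" for i j n n'
  proof -
    obtain \<alpha> \<beta> where 1: "(\<alpha>, i) \<in> s" "(\<beta>, i) \<in> s" "\<alpha> \<in> underS \<kappa>S \<beta>" "j = p (\<alpha>, \<beta>)" "n = c (\<alpha>, \<beta>)"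
      using n(1) by (rule profileE)
    obtain \<alpha>' \<beta>' where 2: "(\<alpha>', i) \<in> s" "(\<beta>', i) \<in> s" "\<alpha>' \<in> underS \<kappa>S \<beta>'" "j = p (\<alpha>', \<beta>')" "n' = c (\<alpha>', \<beta>')"
      using n(2) by (rule profileE)
    have "\<exists>u\<in>conds. {(\<alpha>, i), (\<beta>, i), (\<alpha>', i), (\<beta>', i)} \<subseteq> u" using 1 2 by (intro s(2)) auto
    then obtain u where u: "u \<in> conds" "(\<alpha>, i) \<in> u" "(\<beta>, i) \<in> u" "(\<alpha>', i) \<in> u" "(\<beta>', i) \<in> u" by auto
    have "(i, j, n) \<in> profile u" "(i, j, n') \<in> profile u"
      using profileI[OF u(2,3) 1(3)] profileI[OF u(4,5) 2(3)] 1 2 by simp_all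
    then show ?thesis using u(1) unfolding conds_def by blast
  qed
  ultimately show ?thesis using s(1) unfolding conds_def pfuns_def by blast
qed

text \<open>
  The common part of the two conditions lies below \<open>\<epsilon>\<close>. A pair with one entry in each condition
  but not both entries in one of them has its value under \<open>p\<close> shared with no other pair, so
  homogeneity of the union only concerns the common profile.
\<close>

lemma conds_union:
  assumes q: "q \<in> conds" and r: "r \<in> conds" and prof: "profile q = profile r"
    and low: "\<And>x i. x \<in> underS \<kappa>S \<epsilon> \<Longrightarrow> (x, i) \<in> q \<longleftrightarrow> (x, i) \<in> r"
    and q_below: "Domain q \<subseteq> underS \<kappa>S \<delta>"
    and bad: "\<And>x. x \<in> underS \<kappa>S \<delta> \<Longrightarrow> x \<in> Domain r \<or> (\<exists>\<beta>\<in>Domain r. \<exists>\<beta>'\<in>Domain r. x \<in> collisions p \<beta> \<beta>') \<Longrightarrow>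
      x \<in> underS \<kappa>S \<epsilon>"
  shows "q \<union> r \<in> conds"
proof -
  have qr: "q \<in> pfuns" "r \<in> pfuns" using q r by (auto simp: conds_def)
  \<comment> \<open>By \<open>q_below\<close> a point common to the two domains lies below \<delta>,
    where \<open>bad\<close> applies.\<close>
  have both: "x \<in> underS \<kappa>S \<epsilon>" if "x \<in> Domain q" "x \<in> Domain r" for x
    using that q_below bad by blast
  have sv: "single_valued q" "single_valued r" using qr by (auto simp: pfuns_def)
  have "single_valued (q \<union> r)"
  proof (rule single_valuedI)
    fix x y z assume xy: "(x, y) \<in> q \<union> r" "(x, z) \<in> q \<union> r"
    show "y = z"
    proof (cases "x \<in> underS \<kappa>S \<epsilon>")
      case True
      then show ?thesis using xy low sv by (auto dest: single_valuedD)
    next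
      case False
      then have "x \<notin> Domain q \<or> x \<notin> Domain r" using both by blast
      then show ?thesis using xy sv by (auto dest: single_valuedD)
    qed
  qed
  then have "q \<union> r \<in> pfuns" using qr Un_less[of q r] by (auto simp: pfuns_def)
  \<comment> \<open>A pair in one cell is either accounted for by the common profile or new: its
    lower point then comes from \<open>q\<close>, is not below \<epsilon>, and its upper point lies
    in the domain of \<open>r\<close>.\<close>
  moreover have cross: "(i, p (\<alpha>, \<beta>), c (\<alpha>, \<beta>)) \<in> profile r \<or>
      \<alpha> \<in> underS \<kappa>S \<delta> \<and> \<alpha> \<notin> underS \<kappa>S \<epsilon> \<and> (\<alpha>, i) \<notin> r \<and> \<beta> \<in> Domain r"
    if ab: "(\<alpha>, i) \<in> q \<union> r" "(\<beta>, i) \<in> q \<union> r" "\<alpha> \<in> underS \<kappa>S \<beta>" for i \<alpha> \<beta>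
  proof (cases "{(\<alpha>, i), (\<beta>, i)} \<subseteq> q \<or> {(\<alpha>, i), (\<beta>, i)} \<subseteq> r")
    case True
    then show ?thesis using profileI[of \<alpha> i _ \<beta>] ab(3) prof by auto
  next
    case False
    \<comment> \<open>The opposite mixture is impossible: a point of \<open>r\<close> under a point
      of \<open>q\<close> is below \<delta>, hence below \<epsilon>, where the conditions
      agree.\<close>
    have "\<not> ((\<beta>, i) \<in> q \<and> (\<beta>, i) \<notin> r \<and> (\<alpha>, i) \<in> r \<and> (\<alpha>, i) \<notin> q)"
    proof
      assume h: "(\<beta>, i) \<in> q \<and> (\<beta>, i) \<notin> r \<and> (\<alpha>, i) \<in> r \<and> (\<alpha>, i) \<notin> q"
      then have "\<alpha> \<in> underS \<kappa>S \<delta>" using q_below ab(3) lt_trans by blast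
      then have "\<alpha> \<in> underS \<kappa>S \<epsilon>" using bad h by blast
      then show False using low h by blast
    qed
    then have "(\<alpha>, i) \<in> q" "(\<alpha>, i) \<notin> r" "(\<beta>, i) \<in> r" using False ab(1,2) by auto
    then show ?thesis using q_below low by blast
  qed
  moreover have "n = n'" if n: "(i, j, n) \<in> profile (q \<union> r)" "(i, j, n') \<in> profile (q \<union> r)" for i j n n'
  proof -
    obtain \<alpha> \<beta> where 1: "(\<alpha>, i) \<in> q \<union> r" "(\<beta>, i) \<in> q \<union> r" "\<alpha> \<in> underS \<kappa>S \<beta>" "j = p (\<alpha>, \<beta>)" "n = c (\<alpha>, \<beta>)"
      using n(1) by (rule profileE)
    obtain \<alpha>' \<beta>' where 2: "(\<alpha>', i) \<in> q \<union> r" "(\<beta>', i) \<in> q \<union> r" "\<alpha>' \<in> underS \<kappa>S \<beta>'" "j = p (\<alpha>', \<beta>')" "n' = c (\<alpha>', \<beta>')"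
      using n(2) by (rule profileE)
    \<comment> \<open>The lower point of a new pair is no collision point for \<open>r\<close>, so
      its value determines it among all pairs with upper point in the domain of
      \<open>r\<close>.\<close>
    have key: "(x, y) = (x', y')"
      if x: "x \<in> underS \<kappa>S \<delta>" "x \<notin> underS \<kappa>S \<epsilon>" "y \<in> Domain r" "x \<in> underS \<kappa>S y"
        and x': "x' \<in> underS \<kappa>S y'" "y' \<in> Domain r" "p (x, y) = p (x', y')" for x y x' y'
    proof (rule ccontr)
      assume "(x, y) \<noteq> (x', y')"
      then have "x \<in> collisions p y y'"
        unfolding collisions_def using x(4) x'(3) by (intro CollectI conjI bexI[OF _ x'(1)])
      then show False using bad[OF x(1)] x(2,3) x'(2) by blast
    qed
    \<comment> \<open>The pair realising this value in cell \<open>i\<close> of \<open>r\<close>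
      would be \<open>(x, y)\<close> itself, placing \<open>x\<close> in that cell of
      \<open>r\<close>.\<close>
    have key': False if x: "x \<in> underS \<kappa>S \<delta>" "x \<notin> underS \<kappa>S \<epsilon>" "y \<in> Domain r" "x \<in> underS \<kappa>S y"
        "(x, i) \<notin> r" "(i, p (x, y), m) \<in> profile r" for x y m
    proof -
      obtain x' y' where "(x', i) \<in> r" "(y', i) \<in> r" "x' \<in> underS \<kappa>S y'" "p (x, y) = p (x', y')"
        using x(6) by (rule profileE)
      moreover from this have "(x, y) = (x', y')" by (intro key x) blast+
      ultimately show False using x(5) by blast
    qed
    show ?thesis
    proof (cases "(i, j, n) \<in> profile r")
      case a: True
      show ?thesis
      proof (cases "(i, j, n') \<in> profile r")
        case True
        then show ?thesis using a r unfolding conds_def by blast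
      next
        case False
        then show ?thesis using cross[OF 2(1-3)] key'[of \<alpha>' \<beta>' n] a 2 by auto
      qed
    next
      case False
      then have c1: "\<alpha> \<in> underS \<kappa>S \<delta>" "\<alpha> \<notin> underS \<kappa>S \<epsilon>" "(\<alpha>, i) \<notin> r" "\<beta> \<in> Domain r"
        using cross[OF 1(1-3)] 1 by auto
      show ?thesis
      proof (cases "(i, j, n') \<in> profile r")
        case True
        then show ?thesis using key'[of \<alpha> \<beta> n'] c1 1 by auto
      next
        case False
        then have "\<beta>' \<in> Domain r" using cross[OF 2(1-3)] 2 by auto
        \<comment> \<open>Both pairs are new and have the same value under \<open>p\<close>.\<close>
        then have "(\<alpha>, \<beta>) = (\<alpha>', \<beta>')" using 1 2 c1 by (intro key) simp_all
        then show ?thesis using 1 2 by simp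
      qed
    qed
  qed
  ultimately show ?thesis unfolding conds_def by blast
qed

section \<open>The stationary chain condition\<close>

lemma conds_stationary_cc: "stationary_cc \<kappa> conds (incl conds)"
  unfolding stationary_cc_def
proof
  fix q assume q: "q \<in> Field \<kappa>S \<rightarrow> conds"
  let ?E = "cof_points \<kappa>S (cof \<kappa>)"
  \<comment> \<open>The points where an earlier condition may conflict with
    \<open>q \<delta>\<close>: the points of \<open>q \<delta>\<close> below \<delta> and the
    collisions of its columns.\<close>
  define bad where "bad \<delta> = underS \<kappa>S \<delta> \<inter>
    (Domain (q \<delta>) \<union> (\<Union>(\<beta>, \<beta>')\<in>Domain (q \<delta>) \<times> Domain (q \<delta>). collisions p \<beta> \<beta>'))" for \<delta>
  have qc: "q \<delta> \<in> conds" if "\<delta> \<in> Field \<kappa>S" for \<delta> using q that by blast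
  have dom_F: "Domain (q \<delta>) \<subseteq> Field \<kappa>S" if "\<delta> \<in> Field \<kappa>S" for \<delta>
    using qc[OF that] by (auto simp: conds_def pfuns_def)
  have dom_less: "|Domain (q \<delta>)| <o \<kappa>" if "\<delta> \<in> Field \<kappa>S" for \<delta>
    using Domain_less[OF conds_small[OF qc[OF that]]] .
  have EF: "\<delta> \<in> Field \<kappa>S" if "\<delta> \<in> ?E" for \<delta> using that by (simp add: cof_points_def)
  have "\<exists>\<epsilon>. \<epsilon> \<in> underS \<kappa>S \<delta> \<and> bad \<delta> \<subseteq> underS \<kappa>S \<epsilon>" if \<delta>: "\<delta> \<in> ?E" for \<delta>
  proof -
    note F = EF[OF \<delta>]
    have "|\<Union>(\<beta>, \<beta>')\<in>Domain (q \<delta>) \<times> Domain (q \<delta>). collisions p \<beta> \<beta>'| <o \<kappa>"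
    proof (rule UN_less[OF Times_less[OF dom_less[OF F] dom_less[OF F]]])
      fix x assume "x \<in> Domain (q \<delta>) \<times> Domain (q \<delta>)"
      then show "|case x of (\<beta>, \<beta>') \<Rightarrow> collisions p \<beta> \<beta>'| <o \<kappa>"
        using dom_F[OF F] by (cases x) (auto intro!: collisions_less)
    qed
    then have "|bad \<delta>| <o \<kappa>"
      unfolding bad_def using Un_less[OF dom_less[OF F]] by (intro subset_less[OF Int_lower2])
    moreover have "bad \<delta> \<subseteq> underS \<kappa>S \<delta>" by (simp add: bad_def)
    ultimately show ?thesis using cof_point_bounded[OF \<delta>] by metis
  qed
  then obtain \<epsilon> where \<epsilon>: "\<And>\<delta>. \<delta> \<in> ?E \<Longrightarrow> \<epsilon> \<delta> \<in> underS \<kappa>S \<delta>" "\<And>\<delta>. \<delta> \<in> ?E \<Longrightarrow> bad \<delta> \<subseteq> underS \<kappa>S (\<epsilon> \<delta>)"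
    by metis
  \<comment> \<open>The possible pairs of a restriction below \<open>x\<close> and a profile. There
    are at most \<kappa> of them, so \<open>\<psi> x\<close> codes them in \<kappa>.\<close>
  define T where "T x = {s. s \<subseteq> underS \<kappa>S x \<times> Field \<kappa> \<and> |s| <o \<kappa>} \<times>
    {s. s \<subseteq> Field \<kappa> \<times> Field \<kappa> \<times> Field \<kappa> \<and> |s| <o \<kappa>}" for x
  have T_le: "|T x| \<le>o \<kappa>" for x
    unfolding T_def by (intro Times_le small_subsets_le underS_le ordIso_imp_ordLeq[OF Field_\<kappa>_iso])
  have "\<exists>f. inj_on f (T x) \<and> f ` T x \<subseteq> Field \<kappa>" for x
    by (rule le_\<kappa>_inj[OF T_le[of x]]) blast
  then obtain \<psi> where \<psi>: "\<And>x. inj_on (\<psi> x) (T x)" "\<And>x. \<psi> x ` T x \<subseteq> Field \<kappa>" by metis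
  have "|Field \<kappa>| \<le>o \<kappa>S"
    using ordIso_imp_ordLeq[OF Field_\<kappa>_iso] by (simp add: ordLess_imp_ordLeq flip: less_\<kappa>S_iff)
  then have "|Field \<kappa>S \<times> Field \<kappa>| \<le>o \<kappa>S"
    using ordIso_imp_ordLeq[OF Field_\<kappa>S_iso]
    by (intro card_of_Times_ordLeq_infinite_Field[OF \<kappa>S_infinite _ _ \<kappa>S_card])
  then obtain \<phi> where \<phi>: "inj_on \<phi> (Field \<kappa>S \<times> Field \<kappa>)" "\<phi> ` (Field \<kappa>S \<times> Field \<kappa>) \<subseteq> Field \<kappa>S"
    by (rule le_\<kappa>S_inj)
  \<comment> \<open>\<open>G x\<close> is to bound the domain of \<open>q x\<close> and every code
    with first coordinate \<open>x\<close>. At closure points of \<open>G\<close>, \<open>h\<close>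
    is then regressive and the domains of all earlier conditions lie below \<delta>.\<close>
  have "\<exists>b. b \<in> Field \<kappa>S \<and> Domain (q x) \<union> \<phi> ` ({x} \<times> Field \<kappa>) \<subseteq> underS \<kappa>S b" if x: "x \<in> Field \<kappa>S" for x
  proof -
    have "|{x} \<times> Field \<kappa>| \<le>o \<kappa>"
      by (intro Times_le finite_le ordIso_imp_ordLeq[OF Field_\<kappa>_iso]) simp
    then have "|\<phi> ` ({x} \<times> Field \<kappa>)| \<le>o \<kappa>" by (rule ordLeq_transitive[OF card_of_image])
    then have "|Domain (q x) \<union> \<phi> ` ({x} \<times> Field \<kappa>)| \<le>o \<kappa>"
      using card_of_Un_ordLeq_infinite_Field[OF \<kappa>_infinite ordLess_imp_ordLeq[OF dom_less[OF x]]] \<kappa>_card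
      by blast
    moreover have "Domain (q x) \<union> \<phi> ` ({x} \<times> Field \<kappa>) \<subseteq> Field \<kappa>S"
      using dom_F[OF x] \<phi>(2) x by blast
    ultimately show ?thesis by (metis le_\<kappa>_bounded)
  qed
  then obtain G where G: "\<And>x. x \<in> Field \<kappa>S \<Longrightarrow> G x \<in> Field \<kappa>S"
    "\<And>x. x \<in> Field \<kappa>S \<Longrightarrow> Domain (q x) \<union> \<phi> ` ({x} \<times> Field \<kappa>) \<subseteq> underS \<kappa>S (G x)"
    by metis
  let ?D = "{\<delta> \<in> Field \<kappa>S. \<forall>x \<in> underS \<kappa>S \<delta>. G x \<in> underS \<kappa>S \<delta>}"
  have club: "club \<kappa>S ?D" using G(1) by (rule club_closure_points)
  define low where "low \<delta> = {(x, i) \<in> q \<delta>. x \<in> underS \<kappa>S (\<epsilon> \<delta>)}" for \<delta>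
  define h where "h \<delta> = \<phi> (\<epsilon> \<delta>, \<psi> (\<epsilon> \<delta>) (low \<delta>, profile (q \<delta>)))" for \<delta>
  have inT: "(low \<delta>, profile (q \<delta>)) \<in> T (\<epsilon> \<delta>)" if "\<delta> \<in> ?E" for \<delta>
  proof -
    have qd: "q \<delta> \<in> pfuns" "|q \<delta>| <o \<kappa>" using qc[OF EF[OF that]] by (auto simp: conds_def pfuns_def)
    have "low \<delta> \<subseteq> q \<delta>" by (auto simp: low_def)
    then have "|low \<delta>| <o \<kappa>" using qd(2) by (rule subset_less)
    moreover have "low \<delta> \<subseteq> underS \<kappa>S (\<epsilon> \<delta>) \<times> Field \<kappa>" using qd(1) by (auto simp: low_def pfuns_def)
    ultimately show ?thesis using profile_less[OF qd(2)] profile_subset[OF qd(1)] by (simp add: T_def)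
  qed
  then have \<psi>F: "\<psi> (\<epsilon> \<delta>) (low \<delta>, profile (q \<delta>)) \<in> Field \<kappa>" if "\<delta> \<in> ?E" for \<delta>
    using that by (intro subsetD[OF \<psi>(2)[of "\<epsilon> \<delta>"]] imageI)
  have \<epsilon>F: "\<epsilon> \<delta> \<in> Field \<kappa>S" if "\<delta> \<in> ?E" for \<delta> using \<epsilon>(1)[OF that] by (rule lt_Field)
  have regr: "h \<delta> \<in> underS \<kappa>S \<delta>" if \<delta>: "\<delta> \<in> ?D \<inter> ?E" for \<delta>
  proof -
    have d: "\<delta> \<in> ?E" using \<delta> by blast
    have "h \<delta> \<in> underS \<kappa>S (G (\<epsilon> \<delta>))"
      unfolding h_def using G(2)[OF \<epsilon>F[OF d]] \<psi>F[OF d] by blast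
    moreover have "G (\<epsilon> \<delta>) \<in> underS \<kappa>S \<delta>" using \<delta> \<epsilon>(1)[OF d] by blast
    ultimately show ?thesis by (rule lt_trans)
  qed
  have ordered: "q \<gamma> \<union> q \<delta> \<in> conds"
    if \<gamma>: "\<gamma> \<in> ?E" and \<delta>: "\<delta> \<in> ?D \<inter> ?E" and eq: "h \<gamma> = h \<delta>" and lt: "\<gamma> \<in> underS \<kappa>S \<delta>" for \<gamma> \<delta>
  proof -
    have d: "\<delta> \<in> ?E" using \<delta> by blast
    have "(\<epsilon> \<gamma>, \<psi> (\<epsilon> \<gamma>) (low \<gamma>, profile (q \<gamma>))) = (\<epsilon> \<delta>, \<psi> (\<epsilon> \<delta>) (low \<delta>, profile (q \<delta>)))"
      using \<epsilon>F[OF \<gamma>] \<epsilon>F[OF d] \<psi>F[OF \<gamma>] \<psi>F[OF d]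
      by (intro inj_onD[OF \<phi>(1) eq[unfolded h_def]] SigmaI)
    \<comment> \<open>The coding \<open>\<psi> x\<close> varies with \<open>x\<close>, so the bounds
      must be equal before injectivity of one coding can be applied.\<close>
    then have e: "\<epsilon> \<gamma> = \<epsilon> \<delta>"
      and "\<psi> (\<epsilon> \<delta>) (low \<gamma>, profile (q \<gamma>)) = \<psi> (\<epsilon> \<delta>) (low \<delta>, profile (q \<delta>))" by auto
    then have "(low \<gamma>, profile (q \<gamma>)) = (low \<delta>, profile (q \<delta>))"
      using inT[OF \<gamma>] inT[OF d] by (intro inj_onD[OF \<psi>(1)[of "\<epsilon> \<delta>"]]) simp_all
    then have lowe: "low \<gamma> = low \<delta>" and prof: "profile (q \<gamma>) = profile (q \<delta>)" by simp_all
    show ?thesis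
    proof (rule conds_union[OF qc[OF EF[OF \<gamma>]] qc[OF EF[OF d]] prof])
      fix x i assume "x \<in> underS \<kappa>S (\<epsilon> \<delta>)"
      then have "(x, i) \<in> q \<gamma> \<longleftrightarrow> (x, i) \<in> low \<gamma>" "(x, i) \<in> q \<delta> \<longleftrightarrow> (x, i) \<in> low \<delta>"
        by (simp_all add: low_def e)
      then show "(x, i) \<in> q \<gamma> \<longleftrightarrow> (x, i) \<in> q \<delta>" using lowe by simp
    next
      have "G \<gamma> \<in> underS \<kappa>S \<delta>" using \<delta> lt by blast
      then show "Domain (q \<gamma>) \<subseteq> underS \<kappa>S \<delta>" using G(2)[OF EF[OF \<gamma>]] lt_trans by blast
    next
      fix x assume "x \<in> underS \<kappa>S \<delta>"
        "x \<in> Domain (q \<delta>) \<or> (\<exists>\<beta>\<in>Domain (q \<delta>). \<exists>\<beta>'\<in>Domain (q \<delta>). x \<in> collisions p \<beta> \<beta>')"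
      then have "x \<in> bad \<delta>" unfolding bad_def by blast
      then show "x \<in> underS \<kappa>S (\<epsilon> \<delta>)" using \<epsilon>(2)[OF d] by blast
    qed
  qed
  have "compatible conds (incl conds) (q \<gamma>) (q \<delta>)"
    if g: "\<gamma> \<in> ?D \<inter> ?E" "\<delta> \<in> ?D \<inter> ?E" "h \<gamma> = h \<delta>" for \<gamma> \<delta>
  proof -
    have F: "\<gamma> \<in> Field \<kappa>S" "\<delta> \<in> Field \<kappa>S" using g by auto
    have "q \<gamma> \<union> q \<delta> \<in> conds"
      using lt_linear[OF F] ordered[of \<gamma> \<delta>] ordered[of \<delta> \<gamma>] g qc[OF F(1)] by (auto simp: Un_commute)
    then show ?thesis
      unfolding compatible_def incl_def using qc[OF F(1)] qc[OF F(2)] by blast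
  qed
  then show "\<exists>D h. club \<kappa>S D \<and> (\<forall>\<delta>\<in>D \<inter> ?E. h \<delta> \<in> underS \<kappa>S \<delta>) \<and>
      (\<forall>\<gamma>\<in>D \<inter> ?E. \<forall>\<delta>\<in>D \<inter> ?E. h \<gamma> = h \<delta> \<longrightarrow> compatible conds (incl conds) (q \<gamma>) (q \<delta>))"
    using club regr by (intro exI[of _ ?D] exI[of _ h] conjI ballI impI)
qed

section \<open>Dense sets of conditions\<close>

text \<open>The point goes into a cell that \<open>q\<close> leaves empty; one exists because
  \<open>q\<close> is small. A cell with one point contains no pairs.\<close>

lemma conds_extend_domain:
  assumes q: "q \<in> conds" and \<beta>: "\<beta> \<in> Field \<kappa>S"
  shows "\<exists>r\<in>conds. q \<subseteq> r \<and> \<beta> \<in> Domain r"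
proof (cases "\<beta> \<in> Domain q")
  case False
  obtain i where i: "i \<in> Field \<kappa>" "i \<notin> Range q"
    using less_\<kappa>_exists_not_in[OF Range_less[OF conds_small[OF q]]] .
  let ?r = "{(\<beta>, i)} \<union> q"
  have "profile ?r \<subseteq> profile q"
  proof clarify
    fix k j n assume "(k, j, n) \<in> profile ?r"
    then obtain \<alpha> \<beta>' where 1: "(\<alpha>, k) \<in> ?r" "(\<beta>', k) \<in> ?r" "\<alpha> \<in> underS \<kappa>S \<beta>'" "j = p (\<alpha>, \<beta>')" "n = c (\<alpha>, \<beta>')"
      by (rule profileE)
    then have "(\<alpha>, k) \<in> q" "(\<beta>', k) \<in> q" using i(2) lt_irrefl by auto
    then show "(k, j, n) \<in> profile q" using profileI 1(3-5) by blast
  qed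
  moreover have "?r \<in> pfuns"
    using q False i \<beta> Un_less[OF finite_less[of "{(\<beta>, i)}"] conds_small[OF q]]
    by (auto simp: conds_def pfuns_def single_valued_def)
  ultimately have "?r \<in> conds" using q unfolding conds_def by blast
  then show ?thesis by blast
qed (use q in blast)

lemma fresh_injection:
  assumes "|A| <o \<kappa>" "|S| <o \<kappa>"
  obtains f where "inj_on f A" "f ` A \<subseteq> Field \<kappa> - S"
proof -
  have "\<not> |Field \<kappa> - S| <o \<kappa>"
  proof
    assume "|Field \<kappa> - S| <o \<kappa>"
    then have "|(Field \<kappa> - S) \<union> S| <o \<kappa>" using assms(2) by (rule Un_less)
    then obtain x where "x \<in> Field \<kappa>" "x \<notin> (Field \<kappa> - S) \<union> S" by (rule less_\<kappa>_exists_not_in)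
    then show False by blast
  qed
  then have "\<kappa> \<le>o |Field \<kappa> - S|"
    using \<kappa>_wo by (simp add: not_ordLess_iff_ordLeq card_of_Well_order wo_rel_def)
  then have "|A| \<le>o |Field \<kappa> - S|"
    using assms(1) ordLess_ordLeq_trans ordLess_imp_ordLeq by blast
  then show thesis using that card_of_ordLeq by metis
qed

lemma graph_pfuns:
  assumes "A \<subseteq> Field \<kappa>S" "|A| <o \<kappa>" "f ` A \<subseteq> Field \<kappa>"
  shows "(\<lambda>x. (x, f x)) ` A \<in> pfuns"
  using assms image_less[OF assms(2)] by (auto simp: pfuns_def single_valued_def)

text \<open>Two points \<alpha> < \<beta> above the domain are added to cell \<open>i\<close>, with
  \<open>p (\<alpha>, \<beta>) = j\<close>. Two uses of \<open>pattern\<close> give all other new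
  pairs distinct values that \<open>q\<close> does not realise, and \<open>j\<close> is not yet
  realised in cell \<open>i\<close>.\<close>

lemma conds_realise:
  assumes q: "q \<in> conds" and i: "i \<in> Field \<kappa>" and j: "j \<in> Field \<kappa>"
  shows "\<exists>r\<in>conds. q \<subseteq> r \<and> (\<exists>n. (i, j, n) \<in> profile r)"
proof (cases "\<exists>n. (i, j, n) \<in> profile q")
  case False
  let ?A = "Domain q"
  have A: "?A \<subseteq> Field \<kappa>S" "|?A| <o \<kappa>"
    using q Domain_less[OF conds_small[OF q]] by (auto simp: conds_def pfuns_def)
  \<comment> \<open>Values to avoid: \<open>j\<close> and those already realised by
    \<open>q\<close>.\<close>
  define S where "S = insert j ((\<lambda>(_, k, _). k) ` profile q)"
  have S: "|S| <o \<kappa>"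
    using Un_less[OF finite_less[of "{j}"] image_less[OF profile_less[OF conds_small[OF q]]]]
    by (simp add: S_def)
  obtain f where f: "inj_on f ?A" "f ` ?A \<subseteq> Field \<kappa> - S" by (rule fresh_injection[OF A(2) S])
  have "(\<lambda>x. (x, f x)) ` ?A \<in> pfuns" using f(2) by (intro graph_pfuns A) blast
  then obtain \<alpha> where \<alpha>: "\<alpha> \<in> Field \<kappa>S" "?A \<subseteq> underS \<kappa>S \<alpha>" "\<And>x. x \<in> ?A \<Longrightarrow> p (x, \<alpha>) = f x"
    using pattern[of "(\<lambda>x. (x, f x)) ` ?A"] by (auto simp: Domain_fst image_image)
  \<comment> \<open>Column \<beta> also avoids the values of column \<alpha>; at \<alpha> itself it
    will take the value \<open>j\<close>.\<close>
  obtain g where g: "inj_on g ?A" "g ` ?A \<subseteq> Field \<kappa> - (S \<union> f ` ?A)"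
    by (rule fresh_injection[OF A(2) Un_less[OF S image_less[OF A(2)]]])
  define g' where "g' = g(\<alpha> := j)"
  have \<alpha>A: "\<alpha> \<notin> ?A" using \<alpha>(2) lt_irrefl by blast
  have "(\<lambda>x. (x, g' x)) ` insert \<alpha> ?A \<in> pfuns"
  proof (rule graph_pfuns)
    show "|insert \<alpha> ?A| <o \<kappa>" using Un_less[OF finite_less[of "{\<alpha>}"] A(2)] by simp
    show "g' ` insert \<alpha> ?A \<subseteq> Field \<kappa>" using g(2) j by (auto simp: g'_def)
  qed (use A \<alpha> in blast)
  then obtain \<beta> where \<beta>: "\<beta> \<in> Field \<kappa>S" "insert \<alpha> ?A \<subseteq> underS \<kappa>S \<beta>" "\<And>x. x \<in> insert \<alpha> ?A \<Longrightarrow> p (x, \<beta>) = g' x"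
    using pattern[of "(\<lambda>x. (x, g' x)) ` insert \<alpha> ?A"] by (auto simp: Domain_fst image_image)
  have \<beta>A: "\<beta> \<notin> ?A" "\<alpha> \<noteq> \<beta>" using \<beta>(2) lt_irrefl by auto
  have p\<beta>: "p (\<alpha>, \<beta>) = j" "\<And>x. x \<in> ?A \<Longrightarrow> p (x, \<beta>) = g x"
    using \<beta>(3) \<alpha>A by (auto simp: g'_def)
  let ?r = "{(\<alpha>, i), (\<beta>, i)} \<union> q"
  define New where "New = {(\<alpha>, \<beta>)} \<union> ?A \<times> {\<alpha>} \<union> ?A \<times> {\<beta>}"
  have new: "(k, p (x, y), c (x, y)) \<in> profile q \<or> (x, y) \<in> New"
    if xy: "(x, k) \<in> ?r" "(y, k) \<in> ?r" "x \<in> underS \<kappa>S y" for x y k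
  proof -
    have notin: "\<beta> \<notin> underS \<kappa>S \<alpha>" "\<alpha> \<notin> underS \<kappa>S \<alpha>" "\<beta> \<notin> underS \<kappa>S \<beta>"
      "\<And>a. a \<in> ?A \<Longrightarrow> \<alpha> \<notin> underS \<kappa>S a" "\<And>a. a \<in> ?A \<Longrightarrow> \<beta> \<notin> underS \<kappa>S a"
      using \<alpha>(2) \<beta>(2) lt_irrefl lt_trans by (meson insert_subset subsetD)+
    show ?thesis
    proof (cases "(x, k) \<in> q \<and> (y, k) \<in> q")
      case True
      then show ?thesis using profileI xy(3) by blast
    next
      case False
      then show ?thesis using xy notin by (auto simp: New_def)
    qed
  qed
  have fS: "f a \<notin> S" "g a \<notin> S" if "a \<in> ?A" for a using that f(2) g(2) by blast+
  have New_cases: "(a = \<alpha> \<and> b = \<beta> \<and> p (a, b) = j) \<or> (a \<in> ?A \<and> b = \<alpha> \<and> p (a, b) = f a)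
      \<or> (a \<in> ?A \<and> b = \<beta> \<and> p (a, b) = g a)" if "(a, b) \<in> New" for a b
    using that \<alpha>(3)[of a] p\<beta>(2)[of a] p\<beta>(1) unfolding New_def by blast
  have New_old: "p (x, y) \<notin> S \<or> (x, y) = (\<alpha>, \<beta>)" if "(x, y) \<in> New" for x y
    using New_cases[OF that] fS by metis
  have jS: "j \<in> S" by (simp add: S_def)
  have New_inj: "(x, y) = (x', y')" if "(x, y) \<in> New" "(x', y') \<in> New" "p (x, y) = p (x', y')" for x y x' y'
  proof -
    have fj: "f a \<noteq> j" "g a \<noteq> j" "j \<noteq> f a" "j \<noteq> g a" if "a \<in> ?A" for a using fS[OF that] jS by auto
    have fg: "f a \<noteq> g b" "g b \<noteq> f a" if "a \<in> ?A" "b \<in> ?A" for a b using that g(2) by blast+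
    have ff: "a = b" if "a \<in> ?A" "b \<in> ?A" "f a = f b" for a b using inj_onD[OF f(1) that(3) that(1,2)] .
    have gg: "a = b" if "a \<in> ?A" "b \<in> ?A" "g a = g b" for a b using inj_onD[OF g(1) that(3) that(1,2)] .
    show ?thesis using New_cases[OF that(1)] New_cases[OF that(2)] that(3) fj fg ff gg by metis
  qed
  have old: "k = i \<longrightarrow> l \<noteq> j" "l \<in> S" if "(k, l, n) \<in> profile q" for k l n
    using that False by (auto simp: S_def intro!: image_eqI[of _ _ "(k, l, n)"])
  have New_i: "k = i" if "(x, k) \<in> ?r" "(y, k) \<in> ?r" "(x, y) \<in> New" for x y k
    using that \<alpha>A \<beta>A by (auto simp: New_def)
  have "?r \<in> pfuns"
    using q \<alpha>A \<beta>A i \<alpha>(1) \<beta>(1) Un_less[OF finite_less[of "{(\<alpha>, i), (\<beta>, i)}"] conds_small[OF q]]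
    by (auto simp: conds_def pfuns_def single_valued_def)
  moreover have "n = n'" if n: "(k, l, n) \<in> profile ?r" "(k, l, n') \<in> profile ?r" for k l n n'
  proof -
    obtain x y where 1: "(x, k) \<in> ?r" "(y, k) \<in> ?r" "x \<in> underS \<kappa>S y" "l = p (x, y)" "n = c (x, y)"
      using n(1) by (rule profileE)
    obtain x' y' where 2: "(x', k) \<in> ?r" "(y', k) \<in> ?r" "x' \<in> underS \<kappa>S y'" "l = p (x', y')" "n' = c (x', y')"
      using n(2) by (rule profileE)
    \<comment> \<open>A pair of \<open>q\<close> and an added pair never share cell and value: added
      values lie outside \<open>S\<close> except for \<open>j\<close> at
      \<open>(\<alpha>, \<beta>)\<close>, and \<open>q\<close> does not realise \<open>j\<close> in
      cell \<open>i\<close>.\<close>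
    have excl: False if "(k, l, m) \<in> profile q" "(a, k) \<in> ?r" "(b, k) \<in> ?r" "(a, b) \<in> New" "l = p (a, b)" for m a b
      using old[OF that(1)] New_old[OF that(4)] New_i[OF that(2-4)] that(5) p\<beta>(1) by auto
    consider "(k, l, n) \<in> profile q" "(k, l, n') \<in> profile q" | "(x, y) \<in> New" "(x', y') \<in> New"
      using new[OF 1(1-3)] new[OF 2(1-3)] excl[OF _ 1(1,2) _ 1(4)] excl[OF _ 2(1,2) _ 2(4)]
        1(4,5) 2(4,5) by metis
    then show ?thesis
    proof cases
      case 1
      then show ?thesis using q unfolding conds_def by blast
    next
      case 2
      then have "(x, y) = (x', y')" using New_inj \<open>l = p (x, y)\<close> \<open>l = p (x', y')\<close> by simp
      then show ?thesis using \<open>n = c (x, y)\<close> \<open>n' = c (x', y')\<close> by simp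
    qed
  qed
  ultimately have "?r \<in> conds" unfolding conds_def by blast
  moreover have "(i, j, c (\<alpha>, \<beta>)) \<in> profile ?r"
    using profileI[of \<alpha> i ?r \<beta>] \<beta>(2) p\<beta>(1) by simp
  ultimately show ?thesis by (intro bexI[of _ ?r]) auto
qed (use q in blast)

section \<open>The decomposition read off from a filter\<close>

lemma homogeneous_decomposition:
  assumes "GMA \<kappa>"
  shows "\<exists>X :: 'a \<Rightarrow> 'a set set. disjoint_family_on X (Field \<kappa>) \<and> (\<Union>i\<in>Field \<kappa>. X i) = Field \<kappa>S \<and>
    (\<forall>i\<in>Field \<kappa>. \<forall>j\<in>Field \<kappa>. card {c (\<alpha>, \<beta>) | \<alpha> \<beta>. (\<alpha>, \<beta>) \<in> pairs \<kappa>S (X i) \<and> p (\<alpha>, \<beta>) = j} = 1)"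
proof -
  have ne: "conds \<noteq> {}" using empty_conds by blast
  have "conds \<subseteq> pfuns" by (auto simp: conds_def)
  then have "|conds| <o ctwo ^c \<kappa>"
    using ordLeq_ordLess_trans[OF ordLeq_transitive[OF card_of_mono1 pfuns_le] GMA_cardSuc_less_cexp[OF assms]]
    by blast
  then have P: "GMA_poset \<kappa> conds (incl conds)"
    unfolding GMA_poset_def
    using poset_incl[OF ne] well_met_incl[OF ne conds_small conds_finitary]
      seq_glbs_incl[OF ne conds_small conds_finitary] conds_stationary_cc by blast
  have FF: "|Field \<kappa> \<times> Field \<kappa>| \<le>o \<kappa>"
    using ordIso_imp_ordLeq[OF Field_\<kappa>_iso] by (intro Times_le)
  then have "|Field \<kappa> \<times> Field \<kappa>| \<le>o \<kappa>S"
    by (simp add: ordLess_imp_ordLeq flip: less_\<kappa>S_iff)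
  then have "|Field \<kappa> \<times> Field \<kappa>| \<le>o |Field \<kappa>S|"
    using Field_\<kappa>S_iso ordIso_symmetric ordLeq_ordIso_trans by blast
  moreover have "Field \<kappa> \<times> Field \<kappa> \<noteq> {}" using \<kappa>_infinite by auto
  \<comment> \<open>\<open>s\<close> lists all pairs of a cell and a value, so one family of dense
    sets indexed by \<open>\<kappa>S\<close> handles both covering the points and realising the
    values.\<close>
  ultimately obtain s where s: "s ` Field \<kappa>S = Field \<kappa> \<times> Field \<kappa>"
    using card_of_ordLeq2[of "Field \<kappa> \<times> Field \<kappa>" "Field \<kappa>S"] by auto
  define D where "D \<beta> = {q \<in> conds. \<beta> \<in> Domain q \<and> (\<exists>n. (fst (s \<beta>), snd (s \<beta>), n) \<in> profile q)}" for \<beta>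
  have "dense_in conds (incl conds) (D \<beta>)" if \<beta>: "\<beta> \<in> Field \<kappa>S" for \<beta>
    unfolding dense_in_def
  proof (intro conjI ballI)
    fix q assume q: "q \<in> conds"
    then obtain r where r: "r \<in> conds" "q \<subseteq> r" "\<beta> \<in> Domain r"
      using conds_extend_domain[OF q \<beta>] by blast
    have "s \<beta> \<in> Field \<kappa> \<times> Field \<kappa>" using s \<beta> by blast
    then have "fst (s \<beta>) \<in> Field \<kappa>" "snd (s \<beta>) \<in> Field \<kappa>" by auto
    then obtain t where t: "t \<in> conds" "r \<subseteq> t" "\<exists>n. (fst (s \<beta>), snd (s \<beta>), n) \<in> profile t"
      using conds_realise[OF r(1)] by blast
    have "t \<in> D \<beta>" using t r(3) unfolding D_def by blast
    moreover have "(t, q) \<in> incl conds" using t q r unfolding incl_def by blast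
    ultimately show "\<exists>d\<in>D \<beta>. (d, q) \<in> incl conds" by blast
  qed (auto simp: D_def)
  then obtain G where G: "filter_on conds (incl conds) G" "\<forall>\<beta>\<in>Field \<kappa>S. G \<inter> D \<beta> \<noteq> {}"
    using GMA_any_type[OF assms P, of D] by blast
  have Gc: "G \<subseteq> conds" using G(1) by (simp add: filter_on_def)
  define X where "X i = {\<alpha>. (\<alpha>, i) \<in> \<Union>G}" for i
  have "disjoint_family_on X (Field \<kappa>)"
    unfolding disjoint_family_on_def
  proof (intro ballI impI equals0I)
    fix i i' \<alpha> assume "i \<noteq> i'" "\<alpha> \<in> X i \<inter> X i'"
    then have "{(\<alpha>, i), (\<alpha>, i')} \<subseteq> \<Union>G" by (auto simp: X_def)
    then obtain u where u: "u \<in> G" "{(\<alpha>, i), (\<alpha>, i')} \<subseteq> u"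
      using filter_incl_finite_subset[OF G(1), of "{(\<alpha>, i), (\<alpha>, i')}"] by auto
    then have "single_valued u" using Gc by (auto simp: conds_def pfuns_def)
    then show False using u(2) \<open>i \<noteq> i'\<close> by (auto dest: single_valuedD)
  qed
  moreover have "(\<Union>i\<in>Field \<kappa>. X i) = Field \<kappa>S"
  proof
    show "(\<Union>i\<in>Field \<kappa>. X i) \<subseteq> Field \<kappa>S" using Gc by (auto simp: X_def conds_def pfuns_def)
    show "Field \<kappa>S \<subseteq> (\<Union>i\<in>Field \<kappa>. X i)"
    proof
      fix \<beta> assume "\<beta> \<in> Field \<kappa>S"
      then obtain q where q: "q \<in> G" "q \<in> D \<beta>" using G(2) by blast
      then obtain i where "(\<beta>, i) \<in> q" by (auto simp: D_def)
      moreover have "q \<subseteq> Field \<kappa>S \<times> Field \<kappa>" using q Gc by (auto simp: conds_def pfuns_def)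
      ultimately show "\<beta> \<in> (\<Union>i\<in>Field \<kappa>. X i)" using q(1) unfolding X_def by blast
    qed
  qed
  moreover have "card {c (\<alpha>, \<beta>) | \<alpha> \<beta>. (\<alpha>, \<beta>) \<in> pairs \<kappa>S (X i) \<and> p (\<alpha>, \<beta>) = j} = 1" (is "card ?C = 1")
    if ij: "i \<in> Field \<kappa>" "j \<in> Field \<kappa>" for i j
  proof -
    have "(i, j, n) \<in> profile (\<Union>G)" if n: "n \<in> ?C" for n
    proof -
      obtain \<alpha> \<beta> where "n = c (\<alpha>, \<beta>)" "(\<alpha>, \<beta>) \<in> pairs \<kappa>S (X i)" "p (\<alpha>, \<beta>) = j" using n by blast
      then show ?thesis using profileI[of \<alpha> i "\<Union>G" \<beta>] by (simp add: pairs_def X_def)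
    qed
    moreover have "n \<in> ?C" if n: "(i, j, n) \<in> profile (\<Union>G)" for n
    proof -
      obtain \<alpha> \<beta> where "(\<alpha>, i) \<in> \<Union>G" "(\<beta>, i) \<in> \<Union>G" "\<alpha> \<in> underS \<kappa>S \<beta>" "j = p (\<alpha>, \<beta>)" "n = c (\<alpha>, \<beta>)"
        using n by (rule profileE)
      then show ?thesis by (intro CollectI exI[of _ \<alpha>] exI[of _ \<beta>]) (simp add: pairs_def X_def)
    qed
    ultimately have in_prof: "(i, j, n) \<in> profile (\<Union>G) \<longleftrightarrow> n \<in> ?C" for n by (rule iffI[rotated])
    have "(i, j) \<in> s ` Field \<kappa>S" using ij s by simp
    \<comment> \<open>Meeting the dense set at an index of \<open>(i, j)\<close> provides at least
      one colour.\<close>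
    then obtain \<beta> where \<beta>: "\<beta> \<in> Field \<kappa>S" "s \<beta> = (i, j)" by auto
    then obtain q n where q: "q \<in> G" "(i, j, n) \<in> profile q"
      using G(2)[rule_format, OF \<beta>(1)] by (auto simp: D_def)
    then have "(i, j, n) \<in> profile (\<Union>G)" unfolding profile_def by blast
    moreover have "m = m'" if m: "(i, j, m) \<in> profile (\<Union>G)" "(i, j, m') \<in> profile (\<Union>G)" for m m'
    proof -
      obtain x y where 1: "(x, i) \<in> \<Union>G" "(y, i) \<in> \<Union>G" "x \<in> underS \<kappa>S y" "j = p (x, y)" "m = c (x, y)"
        using m(1) by (rule profileE)
      obtain x' y' where 2: "(x', i) \<in> \<Union>G" "(y', i) \<in> \<Union>G" "x' \<in> underS \<kappa>S y'" "j = p (x', y')" "m' = c (x', y')"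
        using m(2) by (rule profileE)
      \<comment> \<open>Two pairs of points use four elements of the union. They lie in one
        condition, whose homogeneity leaves at most one colour.\<close>
      have "\<exists>u\<in>G. {(x, i), (y, i), (x', i), (y', i)} \<subseteq> u"
        using 1(1,2) 2(1,2) by (intro filter_incl_finite_subset[OF G(1)]) simp_all
      then obtain u where u: "u \<in> G" "(x, i) \<in> u" "(y, i) \<in> u" "(x', i) \<in> u" "(y', i) \<in> u" by auto
      have "(i, j, m) \<in> profile u" "(i, j, m') \<in> profile u"
        using profileI[OF u(2,3) 1(3)] profileI[OF u(4,5) 2(3)] 1 2 by simp_all
      moreover have "u \<in> conds" using u(1) Gc by blast
      ultimately show ?thesis unfolding conds_def by blast
    qed
    ultimately have "?C = {n}" unfolding in_prof by (intro equalityI subsetI) blast+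
    then show ?thesis by simp
  qed
  ultimately show ?thesis by blast
qed

end

section \<open>The countable case\<close>

text \<open>A maximal pairwise disjoint subfamily works. If it were countable, so would be its
  union, and by \<open>thin\<close> only countably many sets could meet that union; by maximality
  all remaining sets do.\<close>

lemma disjoint_uncountable_subfamily:
  assumes unc: "uncountable I" and fin: "\<And>i. i \<in> I \<Longrightarrow> finite (b i)"
    and thin: "\<And>x. countable {i \<in> I. x \<in> b i}"
  obtains J where "J \<subseteq> I" "uncountable J" "\<And>i j. i \<in> J \<Longrightarrow> j \<in> J \<Longrightarrow> i \<noteq> j \<Longrightarrow> b i \<inter> b j = {}"
proof -
  define A where "A = {J. J \<subseteq> I \<and> (\<forall>i\<in>J. \<forall>j\<in>J. i \<noteq> j \<longrightarrow> b i \<inter> b j = {})}"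
  have "\<exists>M\<in>A. \<forall>J\<in>A. M \<subseteq> J \<longrightarrow> J = M"
  proof (rule subset_Zorn')
    fix C assume C: "subset.chain A C"
    have CA: "C \<subseteq> A" and lin: "\<And>X Y. X \<in> C \<Longrightarrow> Y \<in> C \<Longrightarrow> X \<subseteq> Y \<or> Y \<subseteq> X"
      using C by (auto simp: subset_chain_def)
    have "b i \<inter> b j = {}" if ij: "i \<in> \<Union>C" "j \<in> \<Union>C" "i \<noteq> j" for i j
    proof -
      obtain X Y where XY: "X \<in> C" "Y \<in> C" "i \<in> X" "j \<in> Y" using ij by blast
      then obtain Z where "Z \<in> C" "i \<in> Z" "j \<in> Z" using lin[OF XY(1,2)] by blast
      then show ?thesis using CA ij(3) unfolding A_def by blast
    qed
    then show "\<Union>C \<in> A" using CA unfolding A_def by blast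
  qed
  then obtain J where J: "J \<in> A" and max: "\<And>K. K \<in> A \<Longrightarrow> J \<subseteq> K \<Longrightarrow> K = J" by blast
  have JI: "J \<subseteq> I" using J by (simp add: A_def)
  have "uncountable J"
  proof
    assume cJ: "countable J"
    have "countable (\<Union>j\<in>J. b j)"
      by (rule countable_UN[OF cJ]) (use JI fin in \<open>auto intro: countable_finite\<close>)
    then have "countable (J \<union> (\<Union>x\<in>(\<Union>j\<in>J. b j). {i \<in> I. x \<in> b i}))"
      by (intro countable_Un[OF cJ countable_UN] thin)
    moreover have "I \<subseteq> J \<union> (\<Union>x\<in>(\<Union>j\<in>J. b j). {i \<in> I. x \<in> b i})"
    proof
      fix i assume i: "i \<in> I"
      show "i \<in> J \<union> (\<Union>x\<in>(\<Union>j\<in>J. b j). {i \<in> I. x \<in> b i})"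
      proof (cases "\<exists>j\<in>J. b i \<inter> b j \<noteq> {}")
        case True
        then show ?thesis using i by blast
      next
        case False
        then have "insert i J \<in> A" using J i unfolding A_def by blast
        then show ?thesis using max[of "insert i J"] by blast
      qed
    qed
    ultimately show False using unc countable_subset by blast
  qed
  moreover have "b i \<inter> b j = {}" if "i \<in> J" "j \<in> J" "i \<noteq> j" for i j
    using J that by (simp add: A_def)
  ultimately show thesis using that JI by blast
qed

text \<open>Induction on the common size. A point in uncountably many of the sets is removed and
  joins the root; if there is none, an uncountable disjoint subfamily has empty root.\<close>

lemma delta_system_card:
  assumes "uncountable I" "\<And>i. i \<in> I \<Longrightarrow> finite (b i) \<and> card (b i) = n"
  shows "\<exists>J R. J \<subseteq> I \<and> uncountable J \<and> (\<forall>i\<in>J. \<forall>j\<in>J. i \<noteq> j \<longrightarrow> b i \<inter> b j = R)"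
  using assms
proof (induction n arbitrary: I b)
  case 0
  have "b i = {}" if "i \<in> I" for i using 0(2)[OF that] by (metis card_0_eq)
  then show ?case using 0(1) by blast
next
  case (Suc n)
  show ?case
  proof (cases "\<exists>x. uncountable {i \<in> I. x \<in> b i}")
    case True
    then obtain x where x: "uncountable {i \<in> I. x \<in> b i}" ..
    have "\<exists>J R. J \<subseteq> {i \<in> I. x \<in> b i} \<and> uncountable J \<and>
        (\<forall>i\<in>J. \<forall>j\<in>J. i \<noteq> j \<longrightarrow> (b i - {x}) \<inter> (b j - {x}) = R)"
      using Suc.prems(2) by (intro Suc.IH[OF x]) auto
    then obtain J R where J: "J \<subseteq> {i \<in> I. x \<in> b i}" "uncountable J"
      "\<forall>i\<in>J. \<forall>j\<in>J. i \<noteq> j \<longrightarrow> (b i - {x}) \<inter> (b j - {x}) = R" by (elim exE conjE) (rule that)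
    have "b i \<inter> b j = insert x R" if ij: "i \<in> J" "j \<in> J" "i \<noteq> j" for i j
    proof -
      have "(b i - {x}) \<inter> (b j - {x}) = R" using J(3) ij by simp
      moreover have "x \<in> b i" "x \<in> b j" using J(1) ij(1,2) by auto
      ultimately show ?thesis by auto
    qed
    moreover have "J \<subseteq> I" using J(1) by blast
    ultimately show ?thesis using J(2) by (intro exI[of _ J] exI[of _ "insert x R"]) simp
  next
    case False
    have fin: "finite (b i)" if "i \<in> I" for i using Suc.prems(2) that by simp
    obtain J where "J \<subseteq> I" "uncountable J" "\<And>i j. i \<in> J \<Longrightarrow> j \<in> J \<Longrightarrow> i \<noteq> j \<Longrightarrow> b i \<inter> b j = {}"
      by (rule disjoint_uncountable_subfamily[of I b]) (use Suc.prems(1) fin False in auto)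
    then show ?thesis by (intro exI[of _ J] exI[of _ "{}"]) simp
  qed
qed

lemma uncountable_fiber:
  assumes unc: "uncountable I" and "countable (f ` I)"
  obtains y where "uncountable {i \<in> I. f i = y}"
proof (rule ccontr)
  assume "\<not> thesis"
  then have "countable {i \<in> I. f i = y}" for y using that by blast
  then have "countable (\<Union>y\<in>f ` I. {i \<in> I. f i = y})" using assms(2) by (intro countable_UN)
  moreover have "I \<subseteq> (\<Union>y\<in>f ` I. {i \<in> I. f i = y})" by blast
  ultimately show False using unc countable_subset by blast
qed

text \<open>Uncountably many of the sets share one finite size, which reduces to the uniform
  case.\<close>

lemma delta_system:
  assumes unc: "uncountable I" and fin: "\<And>i. i \<in> I \<Longrightarrow> finite (b i)"
  obtains J R where "J \<subseteq> I" "uncountable J" "\<And>i j. i \<in> J \<Longrightarrow> j \<in> J \<Longrightarrow> i \<noteq> j \<Longrightarrow> b i \<inter> b j = R"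
proof -
  obtain n where n: "uncountable {i \<in> I. card (b i) = n}"
    using uncountable_fiber[OF unc, of "\<lambda>i. card (b i)"] by auto
  obtain J R where "J \<subseteq> {i \<in> I. card (b i) = n}" "uncountable J"
    "\<forall>i\<in>J. \<forall>j\<in>J. i \<noteq> j \<longrightarrow> b i \<inter> b j = R"
    using delta_system_card[OF n, of b n] fin by auto
  then show thesis by (intro that[of J R]) auto
qed

lemma countable_finite_maps:
  "countable {F :: 'a::countable \<Rightarrow> 'b::countable option. finite (dom F)}"
proof -
  have "countable (Map.graph ` {F :: 'a \<Rightarrow> 'b option. finite (dom F)})"
    by (rule countable_subset[OF _ countable_Collect_finite]) auto
  moreover have "inj_on Map.graph {F :: 'a \<Rightarrow> 'b option. finite (dom F)}"
    by (intro inj_onI ext) (metis in_graphD in_graphI option.exhaust)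
  ultimately show ?thesis by (rule countable_image_inj_on)
qed

section \<open>The forcing for a finite-to-one partition\<close>

locale finite_to_one_partition =
  fixes p c :: "nat set \<times> nat set \<Rightarrow> nat"
  assumes fto: "finite_to_one_fibers omega1 UNIV p"
begin

text \<open>A condition \<open>(f, F)\<close> promises that colours in cell \<open>(i, j)\<close> stay below \<open>F (i, j)\<close>.\<close>

definition fconds :: "((nat set \<rightharpoonup> nat) \<times> (nat \<times> nat \<rightharpoonup> nat)) set" where
  "fconds = {(f, F). finite (dom f) \<and> dom f \<subseteq> Field omega1 \<and> finite (dom F) \<and>
     (\<forall>\<alpha> \<beta> i. \<alpha> \<in> underS omega1 \<beta> \<longrightarrow> f \<alpha> = Some i \<longrightarrow> f \<beta> = Some i \<longrightarrow>
        (\<exists>n. F (i, p (\<alpha>, \<beta>)) = Some n \<and> c (\<alpha>, \<beta>) \<le> n))}"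

definition fle :: "((nat set \<rightharpoonup> nat) \<times> (nat \<times> nat \<rightharpoonup> nat)) rel" where
  "fle = {(q, r). q \<in> fconds \<and> r \<in> fconds \<and> fst r \<subseteq>\<^sub>m fst q \<and> snd r \<subseteq>\<^sub>m snd q}"

lemma poset_fconds: "poset fconds fle"
proof -
  have "(Map.empty, Map.empty) \<in> fconds" by (simp add: fconds_def)
  then have "fconds \<noteq> {}" by blast
  then show ?thesis
    by (auto simp: poset_def order_on_defs fle_def refl_on_def trans_def antisym_def
        dest: map_le_trans map_le_antisym)
qed

text \<open>The two maps are united. By \<open>avoid\<close> no mixed pair falls under an existing
  bound, so a new and sufficiently large bound can be imposed where mixed pairs occur.\<close>

lemma fconds_amalgamate:
  assumes q: "(f, F) \<in> fconds" and r: "(g, F) \<in> fconds"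
    and agree: "\<And>x. x \<in> dom f \<Longrightarrow> x \<in> dom g \<Longrightarrow> f x = g x"
    and avoid: "\<And>\<alpha> \<beta> i. \<alpha> \<in> underS omega1 \<beta> \<Longrightarrow>
      \<alpha> \<in> dom f - dom g \<and> \<beta> \<in> dom g - dom f \<or> \<alpha> \<in> dom g - dom f \<and> \<beta> \<in> dom f - dom g \<Longrightarrow>
      (i, p (\<alpha>, \<beta>)) \<notin> dom F"
  shows "compatible fconds fle (f, F) (g, F)"
proof -
  define h where "h = f ++ g"
  have hf: "f \<subseteq>\<^sub>m h"
    unfolding map_le_def h_def by (metis agree map_add_dom_app_simps(1,3))
  have hg: "g \<subseteq>\<^sub>m h" by (simp add: h_def)
  have dom_h: "dom h = dom f \<union> dom g" by (auto simp: h_def)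
  define P where "P = {(\<alpha>, \<beta>). \<alpha> \<in> dom h \<and> \<beta> \<in> dom h}"
  have P: "finite P"
    using q r by (auto simp: P_def dom_h fconds_def intro: finite_subset[OF _ finite_SigmaI[of "dom h" "\<lambda>_. dom h"]])
  \<comment> \<open>A sum over the finitely many pairs bounds every single colour.\<close>
  define N where "N = (\<Sum>x\<in>P. c x)"
  define K where "K = (\<lambda>((\<alpha>, \<beta>), i). (i, p (\<alpha>, \<beta>))) ` (P \<times> ran h)"
  have "finite K"
    unfolding K_def using P q r by (intro finite_imageI finite_SigmaI finite_ran) (auto simp: dom_h fconds_def)
  define H where "H x = (if x \<in> dom F then F x else if x \<in> K then Some N else None)" for x
  have "dom H \<subseteq> dom F \<union> K" by (auto simp: H_def split: if_splits)
  then have "finite (dom H)" using \<open>finite K\<close> q by (auto simp: fconds_def intro: finite_subset)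
  have FH: "F \<subseteq>\<^sub>m H" by (auto simp: map_le_def H_def)
  have "\<exists>n. H (i, p (\<alpha>, \<beta>)) = Some n \<and> c (\<alpha>, \<beta>) \<le> n"
    if ab: "\<alpha> \<in> underS omega1 \<beta>" "h \<alpha> = Some i" "h \<beta> = Some i" for \<alpha> \<beta> i
  proof (cases "(\<alpha> \<in> dom f \<and> \<beta> \<in> dom f) \<or> (\<alpha> \<in> dom g \<and> \<beta> \<in> dom g)")
    case True
    then have "(f \<alpha> = Some i \<and> f \<beta> = Some i) \<or> (g \<alpha> = Some i \<and> g \<beta> = Some i)"
      using ab hf hg unfolding map_le_def by metis
    then have "\<exists>n. F (i, p (\<alpha>, \<beta>)) = Some n \<and> c (\<alpha>, \<beta>) \<le> n"
      using q r ab(1) unfolding fconds_def by blast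
    then show ?thesis by (auto simp: H_def)
  next
    case False
    have dom: "\<alpha> \<in> dom h" "\<beta> \<in> dom h" using ab by auto
    then have "(i, p (\<alpha>, \<beta>)) \<notin> dom F" using False avoid[OF ab(1)] unfolding dom_h by blast
    moreover have "((\<alpha>, \<beta>), i) \<in> P \<times> ran h" using dom ab(2) by (auto simp: P_def ran_def)
    then have "(i, p (\<alpha>, \<beta>)) \<in> K" unfolding K_def by (rule rev_image_eqI) simp
    moreover have "c (\<alpha>, \<beta>) \<le> N" unfolding N_def using dom P by (intro member_le_sum) (auto simp: P_def)
    ultimately show ?thesis by (simp add: H_def)
  qed
  then have "(h, H) \<in> fconds"
    using q r \<open>finite (dom H)\<close> by (auto simp: fconds_def dom_h)
  then show ?thesis
    using q r hf hg FH unfolding compatible_def fle_def by (intro bexI[of _ "(h, H)"]) auto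
qed

lemma property_K_fconds: "property_K fconds fle"
  unfolding property_K_def
proof (intro allI impI)
  fix A assume A: "A \<subseteq> fconds" "uncountable A"
  have "countable (snd ` A)"
    by (rule countable_subset[OF _ countable_finite_maps]) (use A(1) in \<open>auto simp: fconds_def\<close>)
  then obtain F where unc1: "uncountable {q \<in> A. snd q = F}" by (rule uncountable_fiber[OF A(2)])
  define A1 where "A1 = {q \<in> A. snd q = F}"
  have A1: "A1 \<subseteq> A" "\<And>q. q \<in> A1 \<Longrightarrow> snd q = F" "uncountable A1" using unc1 by (auto simp: A1_def)
  \<comment> \<open>The values of \<open>p\<close> to which the common bounds \<open>F\<close>
    refer.\<close>
  define S where "S = snd ` dom F"
  have dq: "finite (dom (fst q))" "dom (fst q) \<subseteq> Field omega1" "finite (dom (snd q))" if "q \<in> A1" for q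
  proof -
    have "q \<in> fconds" using that A1(1) A(1) by blast
    then show "finite (dom (fst q))" "dom (fst q) \<subseteq> Field omega1" "finite (dom (snd q))"
      by (cases q; simp add: fconds_def)+
  qed
  have "A1 \<noteq> {}" using A1(3) by auto
  then have "finite S" using dq(3) A1(2) by (auto simp: S_def)
  \<comment> \<open>Points that \<open>p\<close> sends to a value in \<open>S\<close> at some point
    of the domain; finitely many because the fibers are finite.\<close>
  define bad where "bad q = (\<Union>\<beta>\<in>dom (fst q). \<Union>j\<in>S. {\<alpha> \<in> underS omega1 \<beta>. p (\<alpha>, \<beta>) = j})"
    for q :: "(nat set \<rightharpoonup> nat) \<times> (nat \<times> nat \<rightharpoonup> nat)"
  have "finite (bad q)" if "q \<in> A1" for q
    unfolding bad_def using dq[OF that] \<open>finite S\<close> fto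
    by (intro finite_UN_I) (auto simp: finite_to_one_fibers_def)
  then have fin_bad: "finite (dom (fst q) \<union> bad q)" if "q \<in> A1" for q using that dq(1) by blast
  obtain B R where B: "B \<subseteq> A1" "uncountable B"
    "\<And>q r. q \<in> B \<Longrightarrow> r \<in> B \<Longrightarrow> q \<noteq> r \<Longrightarrow> (dom (fst q) \<union> bad q) \<inter> (dom (fst r) \<union> bad r) = R"
    by (rule delta_system[OF A1(3), of "\<lambda>q. dom (fst q) \<union> bad q"]) (rule fin_bad, assumption, rule that)
  obtain q0 where q0: "q0 \<in> B" using B(2) by (metis countable_empty ex_in_conv)
  have "B \<noteq> {q0}" using B(2) by auto
  then obtain q1 where q1: "q1 \<in> B" "q1 \<noteq> q0" using q0 by blast
  have finR: "finite R"
  proof -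
    have "R \<subseteq> dom (fst q0) \<union> bad q0" using B(3)[OF q0 q1(1)] q1(2) by blast
    then show ?thesis using fin_bad B(1) q0 finite_subset by blast
  qed
  \<comment> \<open>The restriction to the root as a set of pairs. The root is finite, so there are
    countably many possibilities and uncountably many conditions share one.\<close>
  define rs where "rs q = {(x, y). x \<in> R \<and> fst q x = Some y}"
    for q :: "(nat set \<rightharpoonup> nat) \<times> (nat \<times> nat \<rightharpoonup> nat)"
  have "rs ` B \<subseteq> {s. finite s \<and> s \<subseteq> R \<times> UNIV}"
  proof clarify
    fix q assume "q \<in> B"
    have "rs q \<subseteq> (\<lambda>x. (x, the (fst q x))) ` R" by (force simp: rs_def)
    then show "finite (rs q) \<and> rs q \<subseteq> R \<times> UNIV" using finR by (auto simp: rs_def intro: finite_subset)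
  qed
  moreover have "countable {s. finite s \<and> s \<subseteq> R \<times> (UNIV :: nat set)}"
    by (intro countable_Collect_finite_subset countable_SIGMA countable_finite[OF finR]) simp
  ultimately have "countable (rs ` B)" by (rule countable_subset)
  then obtain \<rho> where unc2: "uncountable {q \<in> B. rs q = \<rho>}" by (rule uncountable_fiber[OF B(2)])
  let ?C = "{q \<in> B. rs q = \<rho>}"
  have "compatible fconds fle q r" if qr: "q \<in> ?C" "r \<in> ?C" for q r
  proof (cases "q = r")
    case True
    then show ?thesis
      using qr A(1) A1(1) B(1) by (auto simp: compatible_def fle_def intro!: bexI[of _ r])
  next
    case False
    have qB: "q \<in> B" "r \<in> B" using qr by auto
    have qc: "q \<in> fconds" "r \<in> fconds" using qB A(1) A1(1) B(1) by blast+
    have sF: "snd q = F" "snd r = F" using A1(2) B(1) qB by blast+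
    have int: "(dom (fst q) \<union> bad q) \<inter> (dom (fst r) \<union> bad r) = R" using B(3) qB False by blast
    have eqR: "fst q x = fst r x" if x: "x \<in> R" for x
    proof -
      have "(x, y) \<in> rs q \<longleftrightarrow> (x, y) \<in> rs r" for y using qr by simp
      then have "fst q x = Some y \<longleftrightarrow> fst r x = Some y" for y using x by (simp add: rs_def)
      then show ?thesis by (metis option.exhaust)
    qed
    \<comment> \<open>Otherwise \<alpha> would be in \<open>bad v\<close> and so in the root, where
      \<open>u\<close> and \<open>v\<close> agree; but \<alpha> is in the domain of \<open>u\<close>
      only.\<close>
    have av: "(i, p (\<alpha>, \<beta>)) \<notin> dom F"
      if u: "u \<in> B" "v \<in> B" "(dom (fst u) \<union> bad u) \<inter> (dom (fst v) \<union> bad v) = R"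
        "\<And>x. x \<in> R \<Longrightarrow> fst u x = fst v x"
        and ab: "\<alpha> \<in> underS omega1 \<beta>" "\<alpha> \<in> dom (fst u) - dom (fst v)" "\<beta> \<in> dom (fst v)" for u v \<alpha> \<beta> i
    proof
      assume "(i, p (\<alpha>, \<beta>)) \<in> dom F"
      then have "p (\<alpha>, \<beta>) \<in> S" unfolding S_def by (rule rev_image_eqI) simp
      then have "\<alpha> \<in> bad v" unfolding bad_def using ab(1,3) by blast
      then have "\<alpha> \<in> R" using u(3) ab(2) by blast
      then show False using u(4) ab(2) by (auto simp: dom_def)
    qed
    have "compatible fconds fle (fst q, F) (fst r, F)"
    proof (rule fconds_amalgamate)
      show "(fst q, F) \<in> fconds" "(fst r, F) \<in> fconds" using qc sF by (metis prod.collapse)+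
      fix x assume "x \<in> dom (fst q)" "x \<in> dom (fst r)"
      then show "fst q x = fst r x" using int eqR by blast
    next
      fix \<alpha> \<beta> i
      assume "\<alpha> \<in> underS omega1 \<beta>"
        "\<alpha> \<in> dom (fst q) - dom (fst r) \<and> \<beta> \<in> dom (fst r) - dom (fst q) \<or>
         \<alpha> \<in> dom (fst r) - dom (fst q) \<and> \<beta> \<in> dom (fst q) - dom (fst r)"
      moreover have "(dom (fst r) \<union> bad r) \<inter> (dom (fst q) \<union> bad q) = R" using int by blast
      ultimately show "(i, p (\<alpha>, \<beta>)) \<notin> dom F"
        using av[OF qB int eqR] av[OF qB(2,1) _ eqR[symmetric]] by blast
    qed
    then show ?thesis using sF by (metis prod.collapse)
  qed
  then show "\<exists>B\<subseteq>A. uncountable B \<and> (\<forall>q\<in>B. \<forall>r\<in>B. compatible fconds fle q r)"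
    using unc2 B(1) A1(1) by (intro exI[of _ ?C]) blast
qed

text \<open>A cell missing from the finite range receives the new point, which then forms no pair in
  its cell, and the bounds can stay.\<close>

lemma fconds_extend_domain:
  assumes q: "q \<in> fconds" and \<beta>: "\<beta> \<in> Field omega1"
  shows "\<exists>r\<in>fconds. (r, q) \<in> fle \<and> \<beta> \<in> dom (fst r)"
proof (cases "\<beta> \<in> dom (fst q)")
  case True
  then show ?thesis using q by (intro bexI[of _ q]) (auto simp: fle_def)
next
  case False
  obtain f F where fF: "q = (f, F)" by (cases q)
  have "finite (ran f)" using q fF by (auto simp: fconds_def intro: finite_ran)
  then obtain i where i: "i \<notin> ran f" using ex_new_if_finite infinite_UNIV_nat by blast
  have old: "f x \<noteq> Some i" for x using i by (auto simp: ran_def)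
  have irr: "x \<notin> underS omega1 x" for x by (simp add: underS_def)
  have "(f(\<beta> \<mapsto> i), F) \<in> fconds"
    using q \<beta> old irr unfolding fF fconds_def by (auto split: if_splits)
  moreover have "f \<subseteq>\<^sub>m f(\<beta> \<mapsto> i)" using False fF by (auto simp: map_le_def)
  ultimately show ?thesis using q by (intro bexI[of _ "(f(\<beta> \<mapsto> i), F)"]) (auto simp: fF fle_def)
qed

text \<open>Any pair of points in a cell lies in one condition of the filter, which must bound its
  colour. All bounds for \<open>(i, j)\<close> in the filter agree, so one number bounds all colours
  there.\<close>

lemma bounded_decomposition:
  assumes "MA_K"
  shows "\<exists>X :: nat \<Rightarrow> nat set set. disjoint_family X \<and> (\<Union>i. X i) = Field omega1 \<and>
    (\<forall>i j. finite {c (\<alpha>, \<beta>) | \<alpha> \<beta>. (\<alpha>, \<beta>) \<in> pairs omega1 (X i) \<and> p (\<alpha>, \<beta>) = j})"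
proof -
  define D where "D \<beta> = {q \<in> fconds. \<beta> \<in> dom (fst q)}" for \<beta>
  have "dense_in fconds fle (D \<beta>)" if "\<beta> \<in> Field omega1" for \<beta>
    using fconds_extend_domain[OF _ that] unfolding dense_in_def D_def by blast
  then obtain G where G: "filter_on fconds fle G" "\<forall>\<beta>\<in>Field omega1. G \<inter> D \<beta> \<noteq> {}"
    using MA_K_any_type[OF assms poset_fconds property_K_fconds, of D] by blast
  have Gc: "G \<subseteq> fconds" using G(1) by (simp add: filter_on_def)
  have dir: "\<exists>s\<in>G. fst q \<subseteq>\<^sub>m fst s \<and> snd q \<subseteq>\<^sub>m snd s \<and> fst r \<subseteq>\<^sub>m fst s \<and> snd r \<subseteq>\<^sub>m snd s"
    if "q \<in> G" "r \<in> G" for q r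
  proof -
    have "\<exists>s\<in>G. (s, q) \<in> fle \<and> (s, r) \<in> fle" using G(1) that unfolding filter_on_def by blast
    then show ?thesis unfolding fle_def by blast
  qed
  define X where "X i = {\<alpha>. \<exists>q\<in>G. fst q \<alpha> = Some i}" for i
  have "disjoint_family X"
    unfolding disjoint_family_on_def
  proof (intro ballI impI equals0I)
    fix i i' \<alpha> assume "i \<noteq> i'" "\<alpha> \<in> X i \<inter> X i'"
    then obtain q r where qr: "q \<in> G" "r \<in> G" "fst q \<alpha> = Some i" "fst r \<alpha> = Some i'" by (auto simp: X_def)
    obtain s where "s \<in> G" "fst q \<subseteq>\<^sub>m fst s" "fst r \<subseteq>\<^sub>m fst s" using dir[OF qr(1,2)] by blast
    then have "fst s \<alpha> = Some i" "fst s \<alpha> = Some i'" using qr(3,4) unfolding map_le_def by (metis domI)+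
    then show False using \<open>i \<noteq> i'\<close> by simp
  qed
  moreover have "(\<Union>i. X i) = Field omega1"
  proof
    show "(\<Union>i. X i) \<subseteq> Field omega1" using Gc by (fastforce simp: X_def fconds_def)
    show "Field omega1 \<subseteq> (\<Union>i. X i)"
    proof
      fix \<beta> assume "\<beta> \<in> Field omega1"
      then obtain q where "q \<in> G" "q \<in> D \<beta>" using G(2) by blast
      then show "\<beta> \<in> (\<Union>i. X i)" by (auto simp: D_def X_def)
    qed
  qed
  moreover have "finite {c (\<alpha>, \<beta>) | \<alpha> \<beta>. (\<alpha>, \<beta>) \<in> pairs omega1 (X i) \<and> p (\<alpha>, \<beta>) = j}" (is "finite ?C") for i j
  proof -
    have wit: "\<exists>s\<in>G. \<exists>n. snd s (i, j) = Some n \<and> m \<le> n" if m: "m \<in> ?C" for m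
    proof -
      obtain \<alpha> \<beta> where ab: "m = c (\<alpha>, \<beta>)" "\<alpha> \<in> X i" "\<beta> \<in> X i" "\<alpha> \<in> underS omega1 \<beta>" "p (\<alpha>, \<beta>) = j"
        using m unfolding pairs_def by blast
      then obtain q r where qr: "q \<in> G" "r \<in> G" "fst q \<alpha> = Some i" "fst r \<beta> = Some i" by (auto simp: X_def)
      obtain s where s: "s \<in> G" "fst q \<subseteq>\<^sub>m fst s" "fst r \<subseteq>\<^sub>m fst s" using dir[OF qr(1,2)] by blast
      have "fst s \<alpha> = Some i" "fst s \<beta> = Some i" using s qr(3,4) unfolding map_le_def by (metis domI)+
      moreover have "(fst s, snd s) \<in> fconds" using s(1) Gc by auto
      ultimately have "\<exists>n. snd s (i, p (\<alpha>, \<beta>)) = Some n \<and> c (\<alpha>, \<beta>) \<le> n"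
        using ab(4) unfolding fconds_def by blast
      then show ?thesis using s(1) ab by blast
    qed
    \<comment> \<open>Extension never changes an existing bound, so directedness makes the two
      equal.\<close>
    have uniq: "n = n'" if n: "s \<in> G" "s' \<in> G" "snd s (i, j) = Some n" "snd s' (i, j) = Some n'" for s s' n n'
    proof -
      obtain t where "t \<in> G" "snd s \<subseteq>\<^sub>m snd t" "snd s' \<subseteq>\<^sub>m snd t" using dir[OF n(1,2)] by blast
      then have "snd t (i, j) = Some n" "snd t (i, j) = Some n'" using n(3,4) unfolding map_le_def by (metis domI)+
      then show ?thesis by simp
    qed
    show ?thesis
    proof (cases "?C = {}")
      case True
      then show ?thesis by (simp only: finite.emptyI)
    next
      case False
      then obtain m0 where "m0 \<in> ?C" by blast
      then obtain s n where s: "s \<in> G" "snd s (i, j) = Some n" using wit by blast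
      have "?C \<subseteq> {..n}"
      proof
        fix m assume "m \<in> ?C"
        then obtain s' n' where "s' \<in> G" "snd s' (i, j) = Some n'" "m \<le> n'" using wit by blast
        then show "m \<in> {..n}" using uniq[OF s(1) _ s(2)] by auto
      qed
      then show ?thesis using finite_atMost by (rule finite_subset)
    qed
  qed
  ultimately show ?thesis by blast
qed

end

theorem theoremA:
  shows "(\<forall>\<kappa> :: 'a rel.
            Cinfinite \<kappa> \<and> cexp_less \<kappa> =o \<kappa> \<and> GMA \<kappa> \<longrightarrow>
            (\<exists>p \<in> pairs (cardSuc \<kappa>) (Field (cardSuc \<kappa>)) \<rightarrow> Field \<kappa>.
               \<forall>c \<in> pairs (cardSuc \<kappa>) (Field (cardSuc \<kappa>)) \<rightarrow> Field \<kappa>.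
                 \<exists>X :: 'a \<Rightarrow> 'a set set.
                   disjoint_family_on X (Field \<kappa>) \<and>
                   (\<Union>i\<in>Field \<kappa>. X i) = Field (cardSuc \<kappa>) \<and>
                   (\<forall>i\<in>Field \<kappa>. \<forall>j\<in>Field \<kappa>.
                      card {c (\<alpha>, \<beta>) | \<alpha> \<beta>.
                              (\<alpha>, \<beta>) \<in> pairs (cardSuc \<kappa>) (X i) \<and> p (\<alpha>, \<beta>) = j} = 1)))
       \<and>
         (MA_K \<longrightarrow>
            (\<forall>(p :: nat set \<times> nat set \<Rightarrow> nat) (c :: nat set \<times> nat set \<Rightarrow> nat).
               finite_to_one_fibers omega1 UNIV p \<longrightarrow>
               (\<exists>X :: nat \<Rightarrow> nat set set.
                  disjoint_family X \<and>
                  (\<Union>i. X i) = Field omega1 \<and>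
                  (\<forall>i j. finite {c (\<alpha>, \<beta>) | \<alpha> \<beta>.
                                   (\<alpha>, \<beta>) \<in> pairs omega1 (X i) \<and> p (\<alpha>, \<beta>) = j}))))"
proof (intro conjI allI impI)
  fix \<kappa> :: "'a rel" assume \<kappa>: "Cinfinite \<kappa> \<and> cexp_less \<kappa> =o \<kappa> \<and> GMA \<kappa>"
  interpret self_exp \<kappa> by standard (use \<kappa> in auto)
  \<comment> \<open>The partition is obtained from \<kappa> alone, before any colouring is
    given.\<close>
  obtain p where p: "p \<in> pairs \<kappa>S (Field \<kappa>S) \<rightarrow> Field \<kappa>"
    "\<And>\<beta> \<beta>'. \<beta> \<in> Field \<kappa>S \<Longrightarrow> \<beta>' \<in> Field \<kappa>S \<Longrightarrow> |collisions p \<beta> \<beta>'| <o \<kappa>"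
    "\<And>g. g \<in> pfuns \<Longrightarrow> \<exists>\<beta>\<in>Field \<kappa>S. Domain g \<subseteq> underS \<kappa>S \<beta> \<and> (\<forall>(\<gamma>, j)\<in>g. p (\<gamma>, \<beta>) = j)"
    by (rule exists_partition) blast
  show "\<exists>p \<in> pairs \<kappa>S (Field \<kappa>S) \<rightarrow> Field \<kappa>. \<forall>c \<in> pairs \<kappa>S (Field \<kappa>S) \<rightarrow> Field \<kappa>.
    \<exists>X :: 'a \<Rightarrow> 'a set set. disjoint_family_on X (Field \<kappa>) \<and> (\<Union>i\<in>Field \<kappa>. X i) = Field \<kappa>S \<and>
      (\<forall>i\<in>Field \<kappa>. \<forall>j\<in>Field \<kappa>.
         card {c (\<alpha>, \<beta>) | \<alpha> \<beta>. (\<alpha>, \<beta>) \<in> pairs \<kappa>S (X i) \<and> p (\<alpha>, \<beta>) = j} = 1)"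
  proof (intro bexI[OF _ p(1)] ballI)
    fix c assume c: "c \<in> pairs \<kappa>S (Field \<kappa>S) \<rightarrow> Field \<kappa>"
    interpret partition_colouring \<kappa> p c by standard (use p c in blast)+
    show "\<exists>X :: 'a \<Rightarrow> 'a set set. disjoint_family_on X (Field \<kappa>) \<and> (\<Union>i\<in>Field \<kappa>. X i) = Field \<kappa>S \<and>
      (\<forall>i\<in>Field \<kappa>. \<forall>j\<in>Field \<kappa>.
         card {c (\<alpha>, \<beta>) | \<alpha> \<beta>. (\<alpha>, \<beta>) \<in> pairs \<kappa>S (X i) \<and> p (\<alpha>, \<beta>) = j} = 1)"
      by (rule homogeneous_decomposition) (use \<kappa> in blast)
  qed
next
  fix p c :: "nat set \<times> nat set \<Rightarrow> nat"
  assume "MA_K" and p: "finite_to_one_fibers omega1 UNIV p"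
  interpret finite_to_one_partition p c by standard (rule p)
  show "\<exists>X :: nat \<Rightarrow> nat set set. disjoint_family X \<and> (\<Union>i. X i) = Field omega1 \<and>
      (\<forall>i j. finite {c (\<alpha>, \<beta>) | \<alpha> \<beta>. (\<alpha>, \<beta>) \<in> pairs omega1 (X i) \<and> p (\<alpha>, \<beta>) = j})"
    by (rule bounded_decomposition[OF \<open>MA_K\<close>])
qed

end
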